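(* Let $0<s<1$ and let $S_s$ be the Scherk solution of the one-phase free boundary problem with asymptotic slope $s$ (described explicitly in the context). Then the closed loop $\gamma$ of its free boundary lying in the strip $\{|x_2|<\pi\}$ is given by the equation \[ (1-s^2)\cosh\left(\frac{x_1}{1-s^2}\right)=(1+s^2)\cos\left(\frac{x_2}{1+s^2}\right),\qquad |x_2|<\pi . \]
   Context: Identify $\mathbb{R}^2$ with $\mathbb{C}$ via $z=x_1+ix_2$. For $0<s<1$ put $l=2\pi s$ and $b=2s\log(1/s)$, and let \[ \mathcal{S}_l=\{\zeta=u+i\tilde u\in\mathbb{C}:u>0,\ |\tilde u|<l/2\}. \] Define, with the standard branch of the logarithm, \[ \varphi_s(\zeta)=-\tfrac12\log\left(e^{2\pi(\zeta-b)/l}+1\right)+\tfrac12\log\left(e^{-2\pi(\zeta+b)/l}+1\right)+\frac{\pi\zeta}{l}, \qquad \Phi_s(\zeta)=\int_0^\zeta e^{\varphi_s(\eta)}\,d\eta+c_s , \] where $c_s$ is the real constant for which $\mathrm{Re}\,\Phi_s(\zeta)\to0$ as $\zeta\to\pm il/2$. The map $\Phi_s$ is biholomorphic from $\mathcal{S}_l$ onto a domain $\mathcal{D}_s\subset\mathcal{D}=\{(x_1,x_2):x_1>0,\ |x_2|<\pi\}$. The Scherk solution $S_s$ is given on $\mathcal{D}$ by $S_s(z)=\mathrm{Re}\,\zeta$ if $z=\Phi_s(\zeta)$ with $\zeta\in\mathcal{S}_l$, and $S_s(z)=0$ for all other $z\in\mathcal{D}$. It is extended to $\mathbb{R}^2$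 by the symmetries $S_s(\pm x_1,x_2)=S_s(x_1,x_2)=S_s(x_1,\pm x_2)$ and $S_s(x_1,x_2+2\pi)=S_s(x_1,x_2)$ (and by continuity). The free boundary of $S_s$ is $F(S_s)=\partial\{S_s>0\}$. The loop $\gamma$ is the component of $F(S_s)$ contained in $\{|x_2|<\pi\}$; its right half (the part in $x_1>0$) is the image under $\Phi_s$ of $\{\zeta=i\tilde u:|\tilde u|<l/2\}$, and $\gamma$ is symmetric under $x_1\mapsto-x_1$. *)

theory Defs
  imports "HOL-Complex_Analysis.Complex_Analysis"
begin

text \<open>The plane is identified with the type \<^typ>\<open>complex\<close>, \<open>z = x\<^sub>1 + \<i> x\<^sub>2\<close>.\<close>

definition scherk_l :: "real \<Rightarrow> real" where
  "scherk_l s = 2 * pi * s"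

definition scherk_b :: "real \<Rightarrow> real" where
  "scherk_b s = 2 * s * ln (1 / s)"

definition half_strip :: "real \<Rightarrow> complex set" where
  "half_strip l = {\<zeta>. Re \<zeta> > 0 \<and> \<bar>Im \<zeta>\<bar> < l / 2}"

definition scherk_phi :: "real \<Rightarrow> complex \<Rightarrow> complex" where
  "scherk_phi s \<zeta> =
     - (1 / 2) * Ln (exp (2 * of_real pi * (\<zeta> - of_real (scherk_b s)) / of_real (scherk_l s)) + 1)
     + (1 / 2) * Ln (exp (- 2 * of_real pi * (\<zeta> + of_real (scherk_b s)) / of_real (scherk_l s)) + 1)
     + of_real pi * \<zeta> / of_real (scherk_l s)"

definition scherk_primitive :: "real \<Rightarrow> complex \<Rightarrow> complex" where
  "scherk_primitive s \<zeta> = contour_integral (linepath 0 \<zeta>) (\<lambda>\<eta>. exp (scherk_phi s \<eta>))"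

definition scherk_c :: "real \<Rightarrow> real" where
  "scherk_c s = (THE c.
     \<forall>p \<in> {\<i> * of_real (scherk_l s / 2), - \<i> * of_real (scherk_l s / 2)}.
       ((\<lambda>\<zeta>. Re (scherk_primitive s \<zeta> + of_real c)) \<longlongrightarrow> 0) (at p within half_strip (scherk_l s)))"

definition scherk_Phi :: "real \<Rightarrow> complex \<Rightarrow> complex" where
  "scherk_Phi s \<zeta> = scherk_primitive s \<zeta> + of_real (scherk_c s)"

text \<open>The Scherk solution on \<open>\<D> = half_strip (2 * pi)\<close>.\<close>

definition scherk_on_strip :: "real \<Rightarrow> complex \<Rightarrow> real" where
  "scherk_on_strip s z =
     (if z \<in> scherk_Phi s ` half_strip (scherk_l s)
      then Re (the_inv_into (half_strip (scherk_l s)) (scherk_Phi s) z)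
      else 0)"

text \<open>The reflected and translated copies of \<open>\<D>\<close> are dense in the plane, so at most one
  continuous function has the required symmetries and extends \<^const>\<open>scherk_on_strip\<close>.
  The maps \<open>z \<mapsto> - cnj z\<close> and \<open>z \<mapsto> cnj z\<close> change the sign of \<open>x\<^sub>1\<close> and of \<open>x\<^sub>2\<close>.\<close>

definition scherk :: "real \<Rightarrow> complex \<Rightarrow> real" where
  "scherk s = (THE S.
     continuous_on UNIV S \<and>
     (\<forall>z \<in> half_strip (2 * pi). S z = scherk_on_strip s z) \<and>
     (\<forall>z. S (- cnj z) = S z) \<and>
     (\<forall>z. S (cnj z) = S z) \<and>
     (\<forall>z. S (z + 2 * of_real pi * \<i>) = S z))"

definition free_boundary :: "(complex \<Rightarrow> real) \<Rightarrow> complex set" where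
  "free_boundary S = frontier {z. S z > 0}"

definition scherk_loop :: "real \<Rightarrow> complex set" where
  "scherk_loop s = (THE \<gamma>. \<gamma> \<in> components (free_boundary (scherk s)) \<and> \<gamma> \<subseteq> {z. \<bar>Im z\<bar> < pi})"

end

theory Submission
  imports Defs
begin

text \<open>
  The proof gives the Scherk solution in closed form, using one global parameter \<open>q = x + \<i> y\<close>
  of the plane in which the free boundary is visible. Put \<open>A = 1 - s\<^sup>2\<close> and \<open>B = 1 + s\<^sup>2\<close>.

  On the half-strip write \<open>w = exp (\<zeta> / s)\<close> and let \<open>t = exp (\<phi> \<zeta>)\<close> be the derivative of \<open>\<Phi>\<close>. Then
  \<open>t\<^sup>2 = (w + s\<^sup>2) / (s\<^sup>2 w + 1)\<close>, and \<open>t\<close> is a coordinate in which \<open>\<Phi>\<close> integrates to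
  \<open>s\<^sup>2 Ln ((t - s) / (t + s)) + Ln ((1 + s t) / (1 - s t))\<close>; at the two corners \<open>t = \<plusminus>\<i>\<close> both
  quotients have modulus one, so this is the normalised primitive (\<open>scherk_c_eq\<close>). Take the second
  logarithm as the new coordinate \<open>q\<close>. With \<open>E = exp q\<close> the map becomes
  \<open>G q = q + s\<^sup>2 Ln ((A E - B) / (B E - A))\<close>, and \<open>w\<close> becomes a function \<open>W q\<close> affine in
  \<open>cosh q\<close>, so that \<open>S (G q) = s ln \<bar>W q\<bar>\<close>. A direct computation (\<open>norm_W\<close>) shows that
  \<open>\<bar>W q\<bar> > 1\<close> exactly when \<open>A cosh x > B cos y\<close>, and on the curve \<open>A cosh x = B cos y\<close> the quotient
  is \<open>1 / cnj E\<close>, whence \<open>G q = A x + \<i> B y\<close> there. This is the asserted equation of the loop.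

  Besides this computation one has to know that \<open>S\<close> is continuous on the whole plane and where it is
  positive. For this, \<open>G\<close> is extended inside the loop by the same real-linear formula
  \<open>A x + \<i> B y\<close>, and periodically to the inside of the translated loops. Outside, \<open>G\<close> differs from
  the identity by a function with derivative \<open>s\<^sup>2 / W\<close>, of modulus at most \<open>s\<^sup>2\<close>; inside, by
  \<open>- s\<^sup>2 cnj q\<close> up to a constant. Hence \<open>G\<close> is the identity plus a contraction of the plane
  (\<open>displacement_lipschitz\<close>), and Banach's fixed point theorem makes it a homeomorphism of the plane;
  it commutes with the symmetries, which pins down the images of the strips. Consequently
  \<open>s ln (max 1 \<bar>W\<bar>)\<close> transported by \<open>G\<close> is continuous and symmetric and equals the Scherk solution on
  the fundamental half-strip (\<open>height_on_strip\<close>), so it is the Scherk solution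
  (\<open>scherk_eq_height\<close>). Its free boundary is the image under \<open>G\<close> of all curves
  \<open>A cosh x = B cos y\<close>; the part in \<open>\<bar>y\<bar> < pi\<close> is connected and separated from the rest
  by the lines \<open>\<bar>x\<^sub>2\<bar> = pi\<close>, so it is the loop (\<open>scherk_loop_eq\<close>).
\<close>

section \<open>Functions with locally bounded difference quotients\<close>

lemma eventually_bound_of_derivative:
  fixes f :: "complex \<Rightarrow> complex"
  assumes "(f has_field_derivative D) (at q)" "cmod D < M"
  shows "\<forall>\<^sub>F p in nhds q. cmod (f p - f q) \<le> M * cmod (p - q)"
proof -
  have "((\<lambda>p. (f p - f q) / (p - q)) \<longlongrightarrow> D) (at q)"
    using assms(1) by (simp add: has_field_derivative_iff)
  then have "((\<lambda>p. cmod ((f p - f q) / (p - q))) \<longlongrightarrow> cmod D) (at q)"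
    by (rule tendsto_norm)
  then have "\<forall>\<^sub>F p in at q. cmod ((f p - f q) / (p - q)) < M"
    using assms(2) by (rule order_tendstoD)
  then have "\<forall>\<^sub>F p in at q. cmod (f p - f q) \<le> M * cmod (p - q)"
  proof (rule eventually_mono)
    fix p assume "cmod ((f p - f q) / (p - q)) < M"
    then show "cmod (f p - f q) \<le> M * cmod (p - q)"
      by (cases "p = q") (auto simp: norm_divide field_simps)
  qed
  then show ?thesis by (simp add: eventually_nhds_conv_at)
qed

text \<open>A bound that is only required near each point, with that point as one of the two arguments, already
  gives a Lipschitz constant: it propagates along segments. Since differentiability is not asked
  for, a function that is glued from two smooth pieces along a curve can be treated pointwise,
  without any control on how a segment crosses the curve.\<close>

lemma lipschitz_of_eventually_bound:
  fixes f :: "complex \<Rightarrow> complex"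
  assumes loc: "\<And>q. \<forall>\<^sub>F p in nhds q. cmod (f p - f q) \<le> M * cmod (p - q)"
  shows "cmod (f p - f q) \<le> M * cmod (p - q)"
proof -
  have cont: "continuous_on UNIV f"
  proof (rule continuous_at_imp_continuous_on, rule ballI)
    fix q
    have "((\<lambda>p. f p - f q) \<longlongrightarrow> 0) (at q)"
    proof (rule Lim_null_comparison)
      show "\<forall>\<^sub>F p in at q. norm (f p - f q) \<le> M * cmod (p - q)"
        using loc[of q] by (simp add: eventually_nhds_conv_at)
      have "((\<lambda>p. M * cmod (p - q)) \<longlongrightarrow> M * cmod (q - q)) (at q)" by (intro tendsto_intros)
      then show "((\<lambda>p. M * cmod (p - q)) \<longlongrightarrow> 0) (at q)" by simp
    qed
    then show "isCont f q" by (simp add: isCont_def Lim_null[symmetric])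
  qed
  define h where "h x = q + of_real x * (p - q)" for x :: real
  have hc: "continuous_on {0..1} (\<lambda>x. f (h x))"
    by (rule continuous_on_compose2[OF cont]) (auto simp: h_def intro!: continuous_intros)
  have "dist (f (h 1)) (f (h 0)) \<le> (M * cmod (p - q)) * (1 - 0)"
  proof (rule locally_lipschitz_imp_lipschitz_aux)
    fix x :: real assume x: "x \<in> {0..<1}"
    have "(h \<longlongrightarrow> h x) (at_right x)" unfolding h_def by (intro tendsto_intros)
    then have "\<forall>\<^sub>F y in at_right x. cmod (f (h y) - f (h x)) \<le> M * cmod (h y - h x)"
      using loc[of "h x"] by (rule eventually_compose_filterlim[rotated])
    moreover have "\<forall>\<^sub>F y in at_right x. y \<in> {x<..<1}"
      using x by (intro eventually_at_right_real) auto
    ultimately have "\<forall>\<^sub>F y in at_right x. y \<in> {x<..1} \<and> dist (f (h y)) (f (h x)) \<le> (M * cmod (p - q)) * (y - x)"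
    proof eventually_elim
      case (elim y)
      have "h y - h x = of_real (y - x) * (p - q)" by (simp add: h_def algebra_simps)
      then have "cmod (h y - h x) = (y - x) * cmod (p - q)" using elim by (simp add: norm_mult del: of_real_diff)
      then show ?case using elim by (simp add: dist_norm mult.assoc mult.commute[of "cmod (p - q)"])
    qed
    then show "\<exists>y\<in>{x<..1}. dist (f (h y)) (f (h x)) \<le> (M * cmod (p - q)) * (y - x)"
      by (metis (mono_tags, lifting) eventually_happens trivial_limit_at_right_real)
  qed (use hc in auto)
  then show ?thesis by (simp add: h_def dist_norm)
qed

section \<open>Continuous functions determined by their symmetries\<close>

lemma periodic_int:
  fixes S :: "complex \<Rightarrow> real"
  assumes "\<And>z. S (z + p) = S z"
  shows "S (z + of_int k * p) = S z"
proof (induction k rule: int_induct[of _ 0])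
  case base
  show ?case by simp
next
  case (step1 k)
  then show ?case using assms[of "z + of_int k * p"] by (simp add: algebra_simps)
next
  case (step2 k)
  then show ?case using assms[of "z + of_int (k - 1) * p"] by (simp add: algebra_simps)
qed

text \<open>The union of the translates of the half-strip and of its mirror image is dense in the plane.\<close>

lemma symmetric_extension_unique:
  fixes S T :: "complex \<Rightarrow> real"
  assumes cont: "continuous_on UNIV S" "continuous_on UNIV T"
    and eq: "\<And>z. z \<in> half_strip (2 * pi) \<Longrightarrow> S z = T z"
    and reflect: "\<And>z. S (- cnj z) = S z" "\<And>z. T (- cnj z) = T z"
    and period: "\<And>z. S (z + 2 * of_real pi * \<i>) = S z" "\<And>z. T (z + 2 * of_real pi * \<i>) = T z"
  shows "S = T"
proof
  fix z
  have eq': "S z = T z" if "Re z \<noteq> 0" "\<bar>Im z\<bar> < pi" for z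
  proof (cases "0 < Re z")
    case True
    then show ?thesis using that by (intro eq) (auto simp: half_strip_def)
  next
    case False
    then have "S (- cnj z) = T (- cnj z)" using that by (intro eq) (auto simp: half_strip_def)
    then show ?thesis by (simp add: reflect)
  qed
  have closed: "S z = T z" if "\<bar>Im z\<bar> \<le> pi" for z
  proof -
    \<comment> \<open>A path to \<open>z\<close> that leaves the axis \<open>Re = 0\<close> and the lines \<open>\<bar>Im\<bar> = pi\<close> at once.\<close>
    define e :: real where "e = (if 0 \<le> Re z then 1 else -1)"
    define y where "y x = z + of_real (e * x) - \<i> * of_real (x * Im z)" for x :: real
    have "(y \<longlongrightarrow> z + of_real (e * 0) - \<i> * of_real (0 * Im z)) (at_right 0)"
      unfolding y_def by (intro tendsto_intros)
    then have y: "(y \<longlongrightarrow> z) (at_right 0)" by simp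
    have "((\<lambda>x. S (y x)) \<longlongrightarrow> S z) (at_right 0)" "((\<lambda>x. T (y x)) \<longlongrightarrow> T z) (at_right 0)"
      using cont y by (auto intro!: isCont_tendsto_compose[of z] simp: continuous_on_eq_continuous_at)
    moreover have "\<forall>\<^sub>F x in at_right 0. x \<in> {0<..<1::real}" by (intro eventually_at_right_real) simp
    then have "\<forall>\<^sub>F x in at_right 0. S (y x) = T (y x)"
    proof eventually_elim
      case (elim x)
      have "\<bar>Im (y x)\<bar> = (1 - x) * \<bar>Im z\<bar>"
      proof -
        have "Im (y x) = (1 - x) * Im z" by (simp add: y_def algebra_simps)
        then show ?thesis using elim by (simp add: abs_mult)
      qed
      also have "\<dots> \<le> (1 - x) * pi" using that elim by (intro mult_left_mono) auto
      also have "\<dots> < pi" using elim pi_gt_zero by (simp add: algebra_simps)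
      finally show ?case using elim by (intro eq') (auto simp: y_def e_def)
    qed
    ultimately have "((\<lambda>x. T (y x)) \<longlongrightarrow> S z) (at_right 0)" by (blast intro: Lim_transform_eventually)
    with \<open>((\<lambda>x. T (y x)) \<longlongrightarrow> T z) (at_right 0)\<close> show ?thesis
      using tendsto_unique trivial_limit_at_right_real by blast
  qed
  define k where "k = round (Im z / (2 * pi))"
  let ?p = "2 * complex_of_real pi * \<i>"
  have "\<bar>of_int k - Im z / (2 * pi)\<bar> \<le> 1 / 2" unfolding k_def by (rule of_int_round_abs_le)
  then have "\<bar>of_int k - Im z / (2 * pi)\<bar> * (2 * pi) \<le> 1 / 2 * (2 * pi)" by (intro mult_right_mono) auto
  then have "\<bar>(of_int k - Im z / (2 * pi)) * (2 * pi)\<bar> \<le> pi" by (simp add: abs_mult)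
  then have "\<bar>Im (z + of_int (- k) * ?p)\<bar> \<le> pi" by (simp add: algebra_simps abs_minus_commute)
  then have "S (z + of_int (- k) * ?p) = T (z + of_int (- k) * ?p)" by (rule closed)
  then show "S z = T z" using periodic_int[of S ?p z "- k"] periodic_int[of T ?p z "- k"] period by simp
qed

section \<open>Two conformal coordinates outside the loop\<close>

locale scherk_slope =
  fixes s :: real
  assumes s_pos: "0 < s" and s_less_1: "s < 1"
begin

definition A :: real where "A = 1 - s\<^sup>2"
definition B :: real where "B = 1 + s\<^sup>2"

lemma s2: "0 < s\<^sup>2" "s\<^sup>2 < 1"
  using s_pos s_less_1 by (auto simp: power_less_one_iff)

lemma AB: "0 < A" "A < B" "0 < B" "A < 1" "1 < B" "A + B = 2" "B - A = 2 * s\<^sup>2"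
  using s2 by (auto simp: A_def B_def intro: add_pos_pos)

text \<open>The loop is the zero set of \<open>level\<close> in \<open>\<bar>Im q\<bar> < pi\<close>; the solution is positive where it is positive.\<close>

definition level :: "complex \<Rightarrow> real" where
  "level q = A * cosh (Re q) - B * cos (Im q)"

text \<open>The function \<open>exp (\<zeta> / s)\<close> of the half-strip, expressed in the coordinate \<open>q\<close>. It is affine in
  \<open>cosh q\<close> (see \<open>W_cosh\<close>); the factored form shown here is the one in which it occurs as a reciprocal
  logarithmic derivative.\<close>

definition W :: "complex \<Rightarrow> complex" where
  "W q = (of_real A * exp q - of_real B) * (of_real B * exp q - of_real A) / (of_real (2 * (B - A)) * exp q)"

text \<open>This is \<open>(t - s) / (t + s)\<close> if \<open>exp q = (1 + s t) / (1 - s t)\<close>.\<close>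

definition ratio :: "complex \<Rightarrow> complex" where
  "ratio q = (of_real A * exp q - of_real B) / (of_real B * exp q - of_real A)"

text \<open>Inside the loop, \<open>Ln (exp q)\<close> is \<open>q\<close>; inside a translated loop it is the translate of \<open>q\<close> into
  the basic strip, which makes the displacement periodic without mentioning the period.\<close>

definition displacement :: "complex \<Rightarrow> complex" where
  "displacement q = of_real (s\<^sup>2) * (if level q \<ge> 0 then Ln (ratio q) else - cnj (Ln (exp q)))"

definition G :: "complex \<Rightarrow> complex" where
  "G q = q + displacement q"

lemma Re_exp_eq: "2 * Re (exp q) * cosh (Re q) = (cmod (exp q) ^ 2 + 1) * cos (Im q)"
proof -
  have "exp (Re q) * exp (- Re q) = 1" by (simp flip: exp_add)
  then show ?thesis
    by (simp add: cosh_field_def Re_exp power2_eq_square algebra_simps)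
qed

lemma W_cosh: "W q = (of_real (A * B) * cosh q - of_real ((A\<^sup>2 + B\<^sup>2) / 2)) / of_real (B - A)"
proof -
  have ne: "complex_of_real (B - A) \<noteq> 0" "exp q \<noteq> 0" using AB by auto
  have "W q * of_real (B - A) = (of_real (A * B) * cosh q - of_real ((A\<^sup>2 + B\<^sup>2) / 2))"
    using ne unfolding W_def cosh_field_def exp_minus by (simp add: field_simps power2_eq_square)
  then show ?thesis using ne by (simp add: field_simps)
qed

lemma cosh_Re_Im: "Re (cosh q) = cosh (Re q) * cos (Im q)" "Im (cosh q) = sinh (Re q) * sin (Im q)"
  by (simp_all add: cosh_field_def sinh_field_def Re_exp Im_exp field_simps)

text \<open>Since \<open>\<bar>cosh q\<bar>\<^sup>2 = cosh\<^sup>2 x + cos\<^sup>2 y - 1\<close>, the left-hand side is a quadratic polynomial in \<open>cosh x\<close>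
  and \<open>cos y\<close>; its constant term vanishes because \<open>A + B = 2\<close>, and what is left splits into two
  linear factors, of which the second is always positive.\<close>

lemma norm_W: "(B - A)\<^sup>2 * ((cmod (W q))\<^sup>2 - 1) = A * B * level q * (B * cosh (Re q) - A * cos (Im q))"
proof -
  let ?X = "cosh (Re q)" and ?Y = "cos (Im q)"
  let ?C = "of_real (A * B) * cosh q - complex_of_real ((A\<^sup>2 + B\<^sup>2) / 2)"
  have C: "(cmod ?C)\<^sup>2 = (B - A)\<^sup>2 * (cmod (W q))\<^sup>2"
  proof -
    have "?C = of_real (B - A) * W q" using AB(2) unfolding W_cosh by (simp del: of_real_diff)
    then have "cmod ?C = \<bar>B - A\<bar> * cmod (W q)" by (simp only: norm_mult norm_of_real)
    then show ?thesis by (simp add: power_mult_distrib)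
  qed
  have "(cmod ?C)\<^sup>2 = (A * B * (?X * ?Y) - (A\<^sup>2 + B\<^sup>2) / 2)\<^sup>2 + (A * B)\<^sup>2 * ((sinh (Re q))\<^sup>2 * (sin (Im q))\<^sup>2)"
    by (simp add: cmod_power2 cosh_Re_Im power_mult_distrib del: of_real_mult of_real_power of_real_add of_real_divide)
  also have "(sinh (Re q))\<^sup>2 * (sin (Im q))\<^sup>2 = (?X\<^sup>2 - 1) * (1 - ?Y\<^sup>2)"
    by (simp add: cosh_square_eq sin_squared_eq)
  finally have "(B - A)\<^sup>2 * (cmod (W q))\<^sup>2
     = (A * B * (?X * ?Y) - (A\<^sup>2 + B\<^sup>2) / 2)\<^sup>2 + (A * B)\<^sup>2 * ((?X\<^sup>2 - 1) * (1 - ?Y\<^sup>2))" using C by simp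
  moreover have B: "B = 2 - A" using AB by simp
  ultimately show ?thesis unfolding level_def B by (simp add: field_simps power2_eq_square)
qed

lemma second_factor_pos: "0 < B * cosh (Re q) - A * cos (Im q)"
proof -
  have "A * cos (Im q) \<le> A * 1" using AB by (intro mult_left_mono) auto
  also have "\<dots> < B * 1" using AB by simp
  also have "\<dots> \<le> B * cosh (Re q)" using AB by (intro mult_left_mono cosh_real_ge_1) auto
  finally show ?thesis by simp
qed

lemma norm_W_less: "1 < cmod (W q) \<longleftrightarrow> 0 < level q"
  and norm_W_le: "1 \<le> cmod (W q) \<longleftrightarrow> 0 \<le> level q"
proof -
  have k: "0 < A * B * (B * cosh (Re q) - A * cos (Im q))" "0 < (B - A)\<^sup>2" 
    using AB second_factor_pos by auto
  have e: "(B - A)\<^sup>2 * ((cmod (W q))\<^sup>2 - 1) = (A * B * (B * cosh (Re q) - A * cos (Im q))) * level q"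
    using norm_W by (simp add: algebra_simps)
  have "0 < (cmod (W q))\<^sup>2 - 1 \<longleftrightarrow> 0 < level q" 
    by (metis e k zero_less_mult_pos mult_pos_pos)
  moreover have "0 \<le> (cmod (W q))\<^sup>2 - 1 \<longleftrightarrow> 0 \<le> level q"
    using e k by (metis zero_le_mult_iff not_le order_less_imp_le)
  moreover have "(1 < cmod (W q)) = (0 < (cmod (W q))\<^sup>2 - 1)" "(1 \<le> cmod (W q)) = (0 \<le> (cmod (W q))\<^sup>2 - 1)"
    using abs_square_le_1[of "cmod (W q)"] abs_square_less_1[of "cmod (W q)"] by auto
  ultimately show "1 < cmod (W q) \<longleftrightarrow> 0 < level q" "1 \<le> cmod (W q) \<longleftrightarrow> 0 \<le> level q" by auto
qed

text \<open>The real part has the sign of \<open>A B cosh x - (A\<^sup>2 + B\<^sup>2) / 2 cos y\<close>, and \<open>(A\<^sup>2 + B\<^sup>2) / 2 < B\<^sup>2\<close>. Thus the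
  principal logarithm of the quotient is holomorphic across the loop, on a neighbourhood of the closed exterior.\<close>

lemma Re_ratio_pos:
  assumes "0 \<le> level q" shows "0 < Re (ratio q)"
proof -
  let ?X = "cosh (Re q)" and ?Y = "cos (Im q)" and ?E = "exp q"
  have X: "?X > 0" by simp
  have "0 < A * B * ?X - (A\<^sup>2 + B\<^sup>2) / 2 * ?Y"
  proof (cases "?Y > 0")
    case True
    have "(A\<^sup>2 + B\<^sup>2) / 2 < B\<^sup>2" using AB by (simp add: power2_eq_square mult_strict_mono)
    then have "(A\<^sup>2 + B\<^sup>2) / 2 * ?Y < B\<^sup>2 * ?Y" using True by (rule mult_strict_right_mono)
    also have "\<dots> = B * (B * ?Y)" by (simp add: power2_eq_square)
    also have "\<dots> \<le> B * (A * ?X)" using assms AB by (intro mult_left_mono) (auto simp: level_def)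
    finally show ?thesis by (simp add: algebra_simps)
  next
    case False
    then have "(A\<^sup>2 + B\<^sup>2) / 2 * ?Y \<le> 0" by (simp add: mult_nonneg_nonpos)
    moreover have "0 < A * B * ?X" using AB X by simp
    ultimately show ?thesis by linarith
  qed
  then have "0 < (A * B * ?X - (A\<^sup>2 + B\<^sup>2) / 2 * ?Y) * (cmod ?E ^ 2 + 1)"
    by (intro mult_pos_pos) (auto intro: add_nonneg_pos)
  also have "\<dots> = (A * B * (cmod ?E ^ 2 + 1) - (A\<^sup>2 + B\<^sup>2) * Re ?E) * ?X"
    using arg_cong[OF Re_exp_eq[of q], of "\<lambda>x. (A\<^sup>2 + B\<^sup>2) / 2 * x"] by (simp add: algebra_simps del: norm_exp_eq_Re)
  finally have "0 < A * B * (cmod ?E ^ 2 + 1) - (A\<^sup>2 + B\<^sup>2) * Re ?E" using X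
    by (simp add: zero_less_mult_iff)
  also have "\<dots> = Re ((of_real A * ?E - of_real B) * cnj (of_real B * ?E - of_real A))"
    unfolding cmod_power2 by (simp add: algebra_simps power2_eq_square)
  finally have p: "0 < Re ((of_real A * ?E - of_real B) * cnj (of_real B * ?E - of_real A))" .
  then have "of_real B * ?E - of_real A \<noteq> 0" by (intro notI) simp
  then show ?thesis using p unfolding ratio_def Re_complex_div_gt_0 by simp
qed

lemma ratio_slit: "0 \<le> level q \<Longrightarrow> ratio q \<notin> \<real>\<^sub>\<le>\<^sub>0"
  using Re_ratio_pos complex_nonpos_Reals_iff by force

text \<open>This derivative makes \<open>G\<close> controllable: outside the loop \<open>\<bar>W\<bar> \<ge> 1\<close>, so the displacement
  \<open>s\<^sup>2 Ln (ratio q)\<close> has derivative of modulus at most \<open>s\<^sup>2\<close>.\<close>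

lemma has_derivative_Ln_ratio:
  assumes "0 \<le> level q"
  shows "((\<lambda>q. Ln (ratio q)) has_field_derivative 1 / W q) (at q)"
proof -
  let ?n = "of_real A * exp q - of_real B" and ?d = "of_real B * exp q - of_real A"
  have "ratio q \<noteq> 0" using Re_ratio_pos[OF assms] by auto
  then have ne: "?n \<noteq> 0" "?d \<noteq> 0" unfolding ratio_def by auto
  have AB2: "complex_of_real B = 2 - complex_of_real A" 
    using AB(6) by (metis add_diff_cancel_left' of_real_diff of_real_numeral)
  have "(ratio has_field_derivative (of_real A * exp q * ?d - ?n * (of_real B * exp q)) / (?d * ?d)) (at q)"
    unfolding ratio_def using ne by (auto intro!: derivative_eq_intros)
  note DERIV_chain2[OF has_field_derivative_Ln[OF ratio_slit[OF assms]] this]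
  moreover have "inverse (ratio q) * ((of_real A * exp q * ?d - ?n * (of_real B * exp q)) / (?d * ?d)) = 1 / W q"
  proof -
    have "of_real A * exp q * ?d - ?n * (of_real B * exp q) = of_real (2 * (B - A)) * exp q"
      by (simp add: algebra_simps AB2)
    then have "inverse (ratio q) * ((of_real A * exp q * ?d - ?n * (of_real B * exp q)) / (?d * ?d))
      = ?d / ?n * (of_real (2 * (B - A)) * exp q / (?d * ?d))" unfolding ratio_def by simp
    also have "\<dots> = of_real (2 * (B - A)) * exp q / (?n * ?d)" using ne by (simp only: times_divide_times_eq) simp
    finally show ?thesis unfolding W_def by (simp only: divide_divide_eq_right mult_1)
  qed
  ultimately show ?thesis by simp
qed

lemma cos_pos_exp_slit: "level q \<le> 0 \<Longrightarrow> exp q \<notin> \<real>\<^sub>\<le>\<^sub>0"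
proof -
  assume "level q \<le> 0"
  moreover have "0 < A * cosh (Re q)" using AB by simp
  ultimately have "0 < B * cos (Im q)" unfolding level_def by linarith
  then have "0 < Re (exp q)" using AB by (simp add: Re_exp zero_less_mult_iff)
  then show ?thesis using complex_nonpos_Reals_iff by force
qed

text \<open>Clearing denominators, \<open>ratio q = 1 / cnj (exp q)\<close> is the equation \<open>A (\<bar>E\<bar>\<^sup>2 + 1) = 2 B Re E\<close>, and this is the
  equation of the loop multiplied by \<open>2 \<bar>E\<bar>\<close>.\<close>

lemma branches_agree:
  assumes "level q = 0" shows "Ln (ratio q) = - cnj (Ln (exp q))"
proof -
  let ?E = "exp q"
  have "A * (cmod ?E ^ 2 + 1) * cosh (Re q) = 2 * B * Re ?E * cosh (Re q)"
    using Re_exp_eq[of q] assms unfolding level_def by (simp add: algebra_simps)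
  then have e: "A * (cmod ?E ^ 2 + 1) = 2 * B * Re ?E" by simp
  have "(of_real A * ?E - of_real B) * cnj ?E - (of_real B * ?E - of_real A)
      = of_real (A * (cmod ?E ^ 2 + 1) - 2 * B * Re ?E)"
    unfolding cmod_power2 by (auto simp: complex_eq_iff algebra_simps power2_eq_square)
  then have m: "(of_real A * ?E - of_real B) * cnj ?E = (of_real B * ?E - of_real A)"
    using e by (simp only: diff_self of_real_0 right_minus_eq)
  have "ratio q \<noteq> 0" using Re_ratio_pos[of q] assms by auto
  then have "of_real B * ?E - of_real A \<noteq> 0" unfolding ratio_def by auto
  then have "ratio q = inverse (cnj ?E)" unfolding ratio_def using m by (simp add: field_simps)
  then show ?thesis
    using cos_pos_exp_slit[of q] assms by (simp add: Ln_inverse cnj_Ln complex_nonpos_Reals_iff)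
qed

text \<open>Any constant strictly between \<open>s\<^sup>2\<close> and \<open>1\<close> would do: the strict excess over \<open>s\<^sup>2\<close> absorbs the
  error term in the definition of the derivative.\<close>

definition lip :: real where "lip = (1 + s\<^sup>2) / 2"

lemma lip: "s\<^sup>2 < lip" "lip < 1" "0 < lip" using s2 by (auto simp: lip_def intro: add_pos_pos)

section \<open>A homeomorphism of the plane close to the identity\<close>

lemma continuous_level: "continuous_on UNIV level"
  unfolding level_def by (intro continuous_intros)

lemma eventually_level_pos: "0 < level q \<Longrightarrow> \<forall>\<^sub>F p in nhds q. 0 < level p"
  and eventually_level_neg: "level q < 0 \<Longrightarrow> \<forall>\<^sub>F p in nhds q. level p < 0"
proof -
  have "filterlim level (nhds (level q)) (nhds q)"
    using continuous_level unfolding continuous_on_eq_continuous_at[OF open_UNIV] isCont_def tendsto_nhds_iff by simp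
  then show "0 < level q \<Longrightarrow> \<forall>\<^sub>F p in nhds q. 0 < level p" "level q < 0 \<Longrightarrow> \<forall>\<^sub>F p in nhds q. level p < 0"
    by (auto dest: order_tendstoD)
qed

text \<open>Each of the two branches satisfies the bound near \<open>q\<close> whenever \<open>q\<close> lies in the closed region where it is used.
  At a point of the loop both do, and they have the same value there, so it does not matter which branch a
  nearby point belongs to.\<close>

lemma eventually_displacement_bound: "\<forall>\<^sub>F p in nhds q. cmod (displacement p - displacement q) \<le> lip * cmod (p - q)"
proof -
  define H1 where "H1 p = of_real (s\<^sup>2) * Ln (ratio p)" for p
  define H2 where "H2 p = of_real (s\<^sup>2) * - cnj (Ln (exp p))" for p
  have displacement: "displacement p = (if 0 \<le> level p then H1 p else H2 p)" for p by (simp add: displacement_def H1_def H2_def)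
  have c1: "\<forall>\<^sub>F p in nhds q. cmod (H1 p - H1 q) \<le> lip * cmod (p - q)" if "0 \<le> level q"
  proof (rule eventually_bound_of_derivative)
    show "(H1 has_field_derivative of_real (s\<^sup>2) * (1 / W q)) (at q)"
      unfolding H1_def by (rule DERIV_cmult[OF has_derivative_Ln_ratio[OF that]])
    have "cmod (of_real (s\<^sup>2) * (1 / W q)) = s\<^sup>2 / cmod (W q)"
      by (simp add: norm_mult norm_divide norm_power)
    also have "\<dots> \<le> s\<^sup>2" using frac_le[of "s\<^sup>2" "s\<^sup>2" 1 "cmod (W q)"] that norm_W_le[of q] by simp
    finally show "cmod (of_real (s\<^sup>2) * (1 / W q)) < lip" using lip by simp
  qed
  have c2: "\<forall>\<^sub>F p in nhds q. cmod (H2 p - H2 q) \<le> lip * cmod (p - q)" if "level q \<le> 0"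
  proof -
    have "((\<lambda>p. Ln (exp p)) has_field_derivative inverse (exp q) * exp q) (at q)"
      by (rule DERIV_chain2[OF has_field_derivative_Ln[OF cos_pos_exp_slit[OF that]] DERIV_exp])
    then have "((\<lambda>p. of_real (s\<^sup>2) * Ln (exp p)) has_field_derivative of_real (s\<^sup>2)) (at q)"
      using DERIV_cmult[of _ _ _ _ "of_real (s\<^sup>2)"] by fastforce
    then have "\<forall>\<^sub>F p in nhds q. cmod (of_real (s\<^sup>2) * Ln (exp p) - of_real (s\<^sup>2) * Ln (exp q)) \<le> lip * cmod (p - q)"
      by (rule eventually_bound_of_derivative) (use lip in \<open>simp add: norm_power\<close>)
    moreover have "cmod (H2 p - H2 q) = cmod (of_real (s\<^sup>2) * Ln (exp p) - of_real (s\<^sup>2) * Ln (exp q))" for p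
    proof -
      have "H2 p - H2 q = - cnj (of_real (s\<^sup>2) * Ln (exp p) - of_real (s\<^sup>2) * Ln (exp q))"
        by (simp add: H2_def)
      then show ?thesis by (simp only: norm_minus_cancel complex_mod_cnj)
    qed
    ultimately show ?thesis by simp
  qed
  consider "0 < level q" | "level q = 0" | "level q < 0" by linarith
  then show ?thesis
  proof cases
    case 1
    with c1 eventually_level_pos[OF 1] show ?thesis by (auto elim: eventually_elim2 simp: displacement)
  next
    case 2
    then have "H1 q = H2 q" using branches_agree[OF 2] by (simp add: H1_def H2_def)
    have "\<forall>\<^sub>F p in nhds q. cmod (H1 p - H1 q) \<le> lip * cmod (p - q)"
      "\<forall>\<^sub>F p in nhds q. cmod (H2 p - H2 q) \<le> lip * cmod (p - q)" using c1 c2 2 by auto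
    then show ?thesis by (rule eventually_elim2) (use 2 \<open>H1 q = H2 q\<close> in \<open>auto simp: displacement\<close>)
  next
    case 3
    have "\<forall>\<^sub>F p in nhds q. cmod (H2 p - H2 q) \<le> lip * cmod (p - q)" using c2 3 by auto
    then show ?thesis using eventually_level_neg[OF 3]
      by (rule eventually_elim2) (use 3 in \<open>auto simp: displacement\<close>)
  qed
qed

lemma displacement_lipschitz: "cmod (displacement p - displacement q) \<le> lip * cmod (p - q)"
  by (rule lipschitz_of_eventually_bound[OF eventually_displacement_bound])

lemma G_expands: "(1 - lip) * cmod (p - q) \<le> cmod (G p - G q)"
proof -
  have "cmod (p - q) = cmod ((G p - G q) - (displacement p - displacement q))" by (simp add: G_def)
  also have "\<dots> \<le> cmod (G p - G q) + cmod (displacement p - displacement q)" by (rule norm_triangle_ineq4)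
  finally show ?thesis using displacement_lipschitz[of p q] by (simp add: algebra_simps)
qed

lemma bij_G: "bij G"
proof (rule bijI)
  show "inj G"
  proof (rule injI)
    fix p q assume "G p = G q"
    then have "(1 - lip) * cmod (p - q) \<le> 0" using G_expands[of p q] by simp
    then show "p = q" using lip by (simp add: mult_le_0_iff)
  qed
  show "surj G"
  proof (unfold surj_def, rule allI)
    fix z
    have "\<exists>!q. z - displacement q = q"
      by (rule banach_fix_type[of lip]) (use lip displacement_lipschitz in \<open>auto simp: dist_norm norm_minus_commute\<close>)
    then obtain q where "z - displacement q = q" by auto
    then have "z = G q" by (simp add: G_def algebra_simps)
    then show "\<exists>q. z = G q" ..
  qed
qed

lemma homeomorphism_G: "homeomorphism UNIV UNIV G (inv G)"
proof -
  have "continuous_on UNIV (inv G)"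
  proof (rule lipschitz_on_continuous_on[of "1 / (1 - lip)"], rule lipschitz_onI)
    fix x y
    have "(1 - lip) * cmod (inv G x - inv G y) \<le> cmod (x - y)"
      using G_expands[of "inv G x" "inv G y"] bij_G by (simp add: surj_f_inv_f bij_is_surj)
    then show "dist (inv G x) (inv G y) \<le> 1 / (1 - lip) * dist x y"
      using lip by (simp add: dist_norm field_simps)
  qed (use lip in auto)
  moreover have "continuous_on UNIV G"
  proof (rule lipschitz_on_continuous_on[of "1 + lip"], rule lipschitz_onI)
    fix x y
    have "cmod (G x - G y) = cmod ((x - y) + (displacement x - displacement y))" by (simp only: G_def add_diff_add)
    also have "\<dots> \<le> cmod (x - y) + cmod (displacement x - displacement y)" by (rule norm_triangle_ineq)
    finally show "dist (G x) (G y) \<le> (1 + lip) * dist x y"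
      using displacement_lipschitz[of x y] by (simp add: dist_norm algebra_simps)
  qed (use lip in auto)
  ultimately show ?thesis
    using bij_G bij_is_surj[OF bij_imp_bij_inv[OF bij_G]]
    by (simp add: homeomorphism_def bij_is_surj bij_is_inj surj_f_inv_f)
qed

lemma level_symmetric: "level (- cnj q) = level q" "level (cnj q) = level q" "level (q + 2 * of_real pi * \<i>) = level q"
  by (simp_all add: level_def)

lemma exp_period: "exp (q + 2 * of_real pi * \<i>) = exp (q::complex)"
  using exp_plus_2pin[of q 1] by (simp add: mult.assoc mult.commute mult.left_commute)

lemma ratio_reflect: "ratio (- cnj q) = inverse (cnj (ratio q))"
proof -
  let ?F = "cnj (exp q)"
  have Phi_of_slope: "?F \<noteq> 0" by simp
  have "ratio (- cnj q) = (of_real A / ?F - of_real B) / (of_real B / ?F - of_real A)"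
    unfolding ratio_def by (simp add: exp_minus exp_cnj divide_inverse)
  also have "\<dots> = ((of_real A / ?F - of_real B) * ?F) / ((of_real B / ?F - of_real A) * ?F)"
    using Phi_of_slope by (simp only: mult_divide_mult_cancel_right not_False_eq_True)
  also have "\<dots> = (- (of_real B * ?F - of_real A)) / (- (of_real A * ?F - of_real B))"
    by (simp add: left_diff_distrib)
  also have "\<dots> = inverse (cnj (ratio q))" unfolding minus_divide_divide ratio_def by simp
  finally show ?thesis .
qed

lemma G_symmetric: "G (- cnj q) = - cnj (G q)" "G (cnj q) = cnj (G q)"
  "G (q + 2 * of_real pi * \<i>) = G q + 2 * of_real pi * \<i>"
proof -
  have cs: "z \<notin> \<real>\<^sub>\<le>\<^sub>0 \<Longrightarrow> cnj z \<notin> \<real>\<^sub>\<le>\<^sub>0" for z by (simp add: complex_nonpos_Reals_iff)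
  have "displacement (- cnj q) = - cnj (displacement q)"
  proof (cases "0 \<le> level q")
    case True
    have "Ln (ratio (- cnj q)) = - cnj (Ln (ratio q))"
      using ratio_slit[OF True] by (simp add: ratio_reflect Ln_inverse cs cnj_Ln)
    then show ?thesis using True by (simp add: displacement_def level_symmetric)
  next
    case False
    then have "exp q \<notin> \<real>\<^sub>\<le>\<^sub>0" by (intro cos_pos_exp_slit) simp
    moreover from this have "exp (cnj q) \<notin> \<real>\<^sub>\<le>\<^sub>0" using cs[of "exp q"] by (simp add: exp_cnj)
    ultimately have "Ln (exp (- cnj q)) = - cnj (Ln (exp q))"
      by (simp add: exp_minus exp_cnj Ln_inverse cnj_Ln)
    then show ?thesis using False by (simp add: displacement_def level_symmetric)
  qed
  then show "G (- cnj q) = - cnj (G q)" by (simp add: G_def)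
  have "ratio (cnj q) = cnj (ratio q)" by (simp add: ratio_def exp_cnj)
  have "displacement (cnj q) = cnj (displacement q)"
  proof (cases "0 \<le> level q")
    case True
    then show ?thesis using ratio_slit[OF True] by (simp add: displacement_def level_symmetric \<open>ratio (cnj q) = cnj (ratio q)\<close> cnj_Ln)
  next
    case False
    then have "exp q \<notin> \<real>\<^sub>\<le>\<^sub>0" by (intro cos_pos_exp_slit) simp
    then have "Ln (exp (cnj q)) = cnj (Ln (exp q))" by (simp add: cnj_Ln exp_cnj)
    then show ?thesis using False by (simp add: displacement_def level_symmetric)
  qed
  then show "G (cnj q) = cnj (G q)" by (simp add: G_def)
  have "displacement (q + 2 * of_real pi * \<i>) = displacement q" by (simp add: displacement_def level_symmetric ratio_def exp_period)
  then show "G (q + 2 * of_real pi * \<i>) = G q + 2 * of_real pi * \<i>" by (simp add: G_def)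
qed

text \<open>Compares the displacements of \<open>q\<close> and of its mirror image in the imaginary axis, a reflection with
  which \<open>G\<close> commutes. As the constant is
  below one, \<open>G\<close> cannot change the sign of the real part.\<close>

lemma Re_G_near: "\<bar>Re (G q) - Re q\<bar> \<le> lip * \<bar>Re q\<bar>"
proof -
  have "displacement q - displacement (- cnj q) = of_real (2 * (Re (G q) - Re q))"
    using G_symmetric(1)[of q] by (simp add: G_def complex_eq_iff)
  then have "\<bar>2 * (Re (G q) - Re q)\<bar> = cmod (displacement q - displacement (- cnj q))" by (simp only: norm_of_real)
  also have "\<dots> \<le> lip * cmod (q - - cnj q)" by (rule displacement_lipschitz)
  also have "q - - cnj q = of_real (2 * Re q)" by (simp add: complex_eq_iff)
  finally show ?thesis by (simp only: norm_of_real abs_mult) simp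
qed

text \<open>The same argument for the reflection in the line \<open>Im = pi\<close>, which is a composition of conjugation and
  the period.\<close>

lemma Im_G_near: "\<bar>Im (G q) - Im q\<bar> \<le> lip * \<bar>Im q - pi\<bar>"
proof -
  let ?p = "cnj q + 2 * of_real pi * \<i>"
  have "displacement q - displacement ?p = of_real (2 * (Im (G q) - Im q)) * \<i>"
    using G_symmetric(3)[of "cnj q"] G_symmetric(2)[of q] by (simp add: G_def complex_eq_iff)
  then have "\<bar>2 * (Im (G q) - Im q)\<bar> = cmod (displacement q - displacement ?p)"
    by (simp only: norm_of_real norm_mult norm_ii mult_1_right)
  also have "\<dots> \<le> lip * cmod (q - ?p)" by (rule displacement_lipschitz)
  also have "q - ?p = of_real (2 * (Im q - pi)) * \<i>" by (simp add: complex_eq_iff)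
  finally show ?thesis by (simp only: norm_of_real norm_mult norm_ii mult_1_right abs_mult) simp
qed

lemma near_imp_sign:
  fixes x y :: real
  assumes "\<bar>y - x\<bar> \<le> lip * \<bar>x\<bar>" shows "0 < y \<longleftrightarrow> 0 < x"
proof (cases "x = 0")
  case False
  then have "lip * \<bar>x\<bar> < \<bar>x\<bar>" using lip by simp
  then show ?thesis using assms by linarith
qed (use assms in auto)

lemma Re_G_pos_iff: "0 < Re (G q) \<longleftrightarrow> 0 < Re q"
  by (rule near_imp_sign[OF Re_G_near])

lemma Im_G_less_iff: "Im (G q) < pi \<longleftrightarrow> Im q < pi"
  using near_imp_sign[of "pi - Im (G q)" "pi - Im q"] Im_G_near[of q]
  by (simp add: abs_minus_commute)

lemma abs_Im_G_less_iff: "\<bar>Im (G q)\<bar> < pi \<longleftrightarrow> \<bar>Im q\<bar> < pi"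
  using Im_G_less_iff[of q] Im_G_less_iff[of "cnj q"] by (auto simp: G_symmetric abs_less_iff)

text \<open>In the basic strip the principal logarithm undoes \<open>exp\<close>, so inside and on the loop the displacement is \<open>- s\<^sup>2 cnj q\<close>.\<close>

lemma G_linear:
  assumes "level q \<le> 0" "\<bar>Im q\<bar> < pi"
  shows "G q = Complex (A * Re q) (B * Im q)"
proof -
  have "Ln (exp q) = q" using assms by (intro Ln_exp) auto
  then have "displacement q = of_real (s\<^sup>2) * - cnj q"
    using branches_agree[of q] assms by (auto simp: displacement_def)
  then show ?thesis by (simp add: G_def A_def B_def complex_eq_iff algebra_simps)
qed

section \<open>The conformal map in closed form\<close>

definition strip :: "complex set" where "strip = {\<zeta>. \<bar>Im \<zeta>\<bar> < pi * s}"

definition w :: "complex \<Rightarrow> complex" where "w \<zeta> = exp (\<zeta> / of_real s)"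

definition slope :: "complex \<Rightarrow> complex" where "slope \<zeta> = exp (scherk_phi s \<zeta>)"

lemma w_nonzero [simp]: "w \<zeta> \<noteq> 0" by (simp add: w_def)

text \<open>The constant \<open>b\<close> is chosen such that \<open>exp (- b / s) = s\<^sup>2\<close>.\<close>

lemma scherk_phi_eq: "scherk_phi s \<zeta> = - (1 / 2) * Ln (of_real (s\<^sup>2) * w \<zeta> + 1)
    + (1 / 2) * Ln (of_real (s\<^sup>2) * w (- \<zeta>) + 1) + \<zeta> / of_real (2 * s)"
proof -
  have b: "scherk_b s = - 2 * s * ln s" using s_pos by (simp add: scherk_b_def ln_div)
  have "exp (2 * ln s) = s\<^sup>2" using s_pos by (simp add: exp_double)
  then have e: "exp (complex_of_real (2 * ln s)) = of_real (s\<^sup>2)" by (metis exp_of_real)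
  have 1: "2 * of_real pi * (\<zeta> - of_real (scherk_b s)) / of_real (scherk_l s)
      = complex_of_real (2 * ln s) + \<zeta> / of_real s"
    using s_pos by (simp add: scherk_l_def b field_simps)
  have 2: "- 2 * of_real pi * (\<zeta> + of_real (scherk_b s)) / of_real (scherk_l s)
      = complex_of_real (2 * ln s) + (- \<zeta>) / of_real s"
    using s_pos by (simp add: scherk_l_def b field_simps)
  have 3: "of_real pi * \<zeta> / of_real (scherk_l s) = \<zeta> / of_real (2 * s)"
    by (simp add: scherk_l_def)
  show ?thesis unfolding scherk_phi_def 1 2 3 exp_add e w_def ..
qed

lemma half_strip_subset: "half_strip (scherk_l s) \<subseteq> strip"
  and half_strip_eq: "half_strip (scherk_l s) = {\<zeta> \<in> strip. 0 < Re \<zeta>}"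
  by (auto simp: half_strip_def scherk_l_def strip_def)

lemma w_slit: "\<zeta> \<in> strip \<Longrightarrow> w \<zeta> \<notin> \<real>\<^sub>\<le>\<^sub>0"
proof
  assume z: "\<zeta> \<in> strip" "w \<zeta> \<in> \<real>\<^sub>\<le>\<^sub>0"
  have im: "- pi < Im \<zeta> / s" "Im \<zeta> / s < pi"
    using z(1) s_pos by (auto simp: strip_def field_simps abs_less_iff)
  then have "Ln (w \<zeta>) = \<zeta> / of_real s" unfolding w_def by (intro Ln_exp) auto
  moreover have "Re (w \<zeta>) < 0 \<and> Im (w \<zeta>) = 0"
    using z(2) w_nonzero[of \<zeta>] by (auto simp: complex_nonpos_Reals_iff complex_eq_iff less_le)
  then have "Im (Ln (w \<zeta>)) = pi" by (simp add: Im_Ln_eq_pi)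
  ultimately show False using im by simp
qed

lemma affine_slit:
  fixes z :: complex
  assumes "z \<notin> \<real>\<^sub>\<le>\<^sub>0" shows "of_real (s\<^sup>2) * z + 1 \<notin> \<real>\<^sub>\<le>\<^sub>0"
proof
  assume "of_real (s\<^sup>2) * z + 1 \<in> \<real>\<^sub>\<le>\<^sub>0"
  then have "s\<^sup>2 * Re z + 1 \<le> 0" "s\<^sup>2 * Im z = 0"
    by (auto simp: complex_nonpos_Reals_iff simp del: of_real_power)
  then have "s\<^sup>2 * Re z \<le> 0" "Im z = 0" using s2 by auto
  then have "Re z \<le> 0" "Im z = 0" using s2 by (auto simp: mult_le_0_iff)
  then show False using assms by (simp add: complex_nonpos_Reals_iff)
qed

lemma strip_uminus: "\<zeta> \<in> strip \<Longrightarrow> - \<zeta> \<in> strip" by (simp add: strip_def)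

lemma w_uminus: "w (- \<zeta>) = 1 / w \<zeta>" by (simp add: w_def exp_minus divide_inverse)

lemma affine_w_slit:
  assumes "\<zeta> \<in> strip"
  shows "of_real (s\<^sup>2) * w \<zeta> + 1 \<notin> \<real>\<^sub>\<le>\<^sub>0" "of_real (s\<^sup>2) * w (- \<zeta>) + 1 \<notin> \<real>\<^sub>\<le>\<^sub>0"
  using assms strip_uminus[OF assms] by (auto intro!: affine_slit dest: w_slit simp del: of_real_power)

lemma slope_square:
  assumes "\<zeta> \<in> strip"
  shows "(slope \<zeta>)\<^sup>2 * (of_real (s\<^sup>2) * w \<zeta> + 1) = w \<zeta> + of_real (s\<^sup>2)"
proof -
  have ne: "of_real (s\<^sup>2) * w \<zeta> + 1 \<noteq> 0" "of_real (s\<^sup>2) * w (- \<zeta>) + 1 \<noteq> 0"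
    using affine_w_slit[OF assms] by (metis nonpos_Reals_zero_I)+
  have "(slope \<zeta>)\<^sup>2 = exp (2 * scherk_phi s \<zeta>)"
    by (simp add: slope_def exp_double)
  also have "2 * scherk_phi s \<zeta> = - Ln (of_real (s\<^sup>2) * w \<zeta> + 1) + (Ln (of_real (s\<^sup>2) * w (- \<zeta>) + 1) + \<zeta> / of_real s)"
    by (simp add: scherk_phi_eq field_simps del: of_real_power)
  also have "exp \<dots> = exp (- Ln (of_real (s\<^sup>2) * w \<zeta> + 1)) * (exp (Ln (of_real (s\<^sup>2) * w (- \<zeta>) + 1)) * w \<zeta>)"
    by (simp only: exp_add w_def)
  also have "\<dots> = inverse (of_real (s\<^sup>2) * w \<zeta> + 1) * ((of_real (s\<^sup>2) * w (- \<zeta>) + 1) * w \<zeta>)"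
    by (simp only: exp_minus exp_Ln[OF ne(1)] exp_Ln[OF ne(2)])
  finally have "(slope \<zeta>)\<^sup>2 * (of_real (s\<^sup>2) * w \<zeta> + 1) = (of_real (s\<^sup>2) * w (- \<zeta>) + 1) * w \<zeta>"
    using ne by (simp add: field_simps del: of_real_power)
  also have "\<dots> = w \<zeta> + of_real (s\<^sup>2)" by (simp add: w_uminus field_simps)
  finally show ?thesis .
qed

lemma AB_of_real: "complex_of_real A = 1 - (of_real s)\<^sup>2" "complex_of_real B = 1 + (of_real s)\<^sup>2"
  "complex_of_real (2 * (B - A)) = 4 * (of_real s)\<^sup>2"
  by (simp_all add: A_def B_def)

lemma s4_ne: "(complex_of_real s)^4 \<noteq> 1"
proof
  assume "(complex_of_real s)^4 = 1"
  then have "complex_of_real (s^4) = of_real 1" by simp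
  then have "s^4 = 1" by (simp only: of_real_eq_iff)
  moreover have "s^4 < 1" using s_pos s_less_1 by (simp add: power_less_one_iff)
  ultimately show False by simp
qed

text \<open>The relation between \<open>t\<^sup>2\<close> and \<open>w\<close> is a Moebius transformation; these are the forms in which its inverse is
  used.\<close>

lemma slope_identities:
  assumes "\<zeta> \<in> strip"
  shows "1 - (of_real s)\<^sup>2 * (slope \<zeta>)\<^sup>2 = (1 - (of_real s)^4) / (of_real s^2 * w \<zeta> + 1)"
    and "(slope \<zeta>)\<^sup>2 - (of_real s)\<^sup>2 = w \<zeta> * (1 - (of_real s)^4) / (of_real s^2 * w \<zeta> + 1)"
    and "1 - (of_real s)\<^sup>2 * (slope \<zeta>)\<^sup>2 \<noteq> 0"
    and "w \<zeta> = ((slope \<zeta>)\<^sup>2 - (of_real s)\<^sup>2) / (1 - (of_real s)\<^sup>2 * (slope \<zeta>)\<^sup>2)"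
proof -
  have ne: "of_real s ^ 2 * w \<zeta> + 1 \<noteq> 0"
    using affine_w_slit[OF assms] by (metis nonpos_Reals_zero_I of_real_power)
  have t2: "(slope \<zeta>)\<^sup>2 = (w \<zeta> + of_real s ^ 2) / (of_real s ^ 2 * w \<zeta> + 1)"
    using slope_square[OF assms] ne by (simp add: eq_divide_eq)
  show 1: "1 - (of_real s)\<^sup>2 * (slope \<zeta>)\<^sup>2 = (1 - (of_real s)^4) / (of_real s^2 * w \<zeta> + 1)"
    unfolding t2 using ne by (simp add: field_simps power4_eq_xxxx power2_eq_square)
  show 2: "(slope \<zeta>)\<^sup>2 - (of_real s)\<^sup>2 = w \<zeta> * (1 - (of_real s)^4) / (of_real s^2 * w \<zeta> + 1)"
    unfolding t2 using ne by (simp add: field_simps power4_eq_xxxx power2_eq_square)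
  show "1 - (of_real s)\<^sup>2 * (slope \<zeta>)\<^sup>2 \<noteq> 0" unfolding 1 using ne s4_ne by simp
  show "w \<zeta> = ((slope \<zeta>)\<^sup>2 - (of_real s)\<^sup>2) / (1 - (of_real s)\<^sup>2 * (slope \<zeta>)\<^sup>2)"
    unfolding 1 2 using ne s4_ne by simp
qed

lemma has_derivative_phi:
  assumes "\<zeta> \<in> strip"
  shows "(scherk_phi s has_field_derivative
     w \<zeta> * (1 - (of_real s)^4) / (2 * of_real s * (of_real s^2 * w \<zeta> + 1) * (w \<zeta> + of_real s^2))) (at \<zeta>)"
proof -
  have ne: "of_real s ^ 2 * w \<zeta> + 1 \<noteq> 0" "of_real s ^ 2 * w (-\<zeta>) + 1 \<noteq> 0"
    using affine_w_slit[OF assms] by (metis nonpos_Reals_zero_I of_real_power)+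
  have ne2: "w \<zeta> + of_real s ^ 2 \<noteq> 0" using ne(2) by (simp add: w_uminus field_simps)
  have s0: "complex_of_real s \<noteq> 0" using s_pos by simp
  have dw: "(w has_field_derivative w \<zeta> / of_real s) (at \<zeta>)" for \<zeta>
    unfolding w_def using s0 by (auto intro!: derivative_eq_intros)
  have dw': "((\<lambda>x. w (- x)) has_field_derivative - (w (-\<zeta>) / of_real s)) (at \<zeta>)"
    unfolding w_def using s0 by (auto intro!: derivative_eq_intros)
  have d1: "((\<lambda>x. of_real (s\<^sup>2) * w x + 1) has_field_derivative of_real (s\<^sup>2) * (w \<zeta> / of_real s) + 0) (at \<zeta>)"
    by (intro DERIV_add DERIV_cmult DERIV_const dw)
  have d2: "((\<lambda>x. of_real (s\<^sup>2) * w (- x) + 1) has_field_derivative of_real (s\<^sup>2) * - (w (- \<zeta>) / of_real s) + 0) (at \<zeta>)"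
    by (intro DERIV_add DERIV_cmult DERIV_const dw')
  have "(scherk_phi s has_field_derivative
     - (1/2) * (inverse (of_real (s\<^sup>2) * w \<zeta> + 1) * (of_real (s\<^sup>2) * (w \<zeta> / of_real s) + 0)) +
     (1/2) * (inverse (of_real (s\<^sup>2) * w (-\<zeta>) + 1) * (of_real (s\<^sup>2) * - (w (-\<zeta>) / of_real s) + 0)) + 1 / of_real (2 * s)) (at \<zeta>)"
    unfolding scherk_phi_eq[abs_def]
    by (intro DERIV_add DERIV_cmult DERIV_cdivide DERIV_ident
        DERIV_chain2[OF has_field_derivative_Ln d1] DERIV_chain2[OF has_field_derivative_Ln d2] affine_w_slit[OF assms])
  then have "(scherk_phi s has_field_derivative
     - (1/2) * ((of_real (s\<^sup>2) * (w \<zeta> / of_real s)) / (of_real (s\<^sup>2) * w \<zeta> + 1)) +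
     (1/2) * ((of_real (s\<^sup>2) * - (w (-\<zeta>) / of_real s)) / (of_real (s\<^sup>2) * w (-\<zeta>) + 1)) + 1 / of_real (2 * s)) (at \<zeta>)"
    by (simp only: add_0_right divide_inverse mult.commute mult.left_commute)
  moreover have "- (1/2) * ((of_real (s\<^sup>2) * (w \<zeta> / of_real s)) / (of_real (s\<^sup>2) * w \<zeta> + 1)) +
     (1/2) * ((of_real (s\<^sup>2) * - (w (-\<zeta>) / of_real s)) / (of_real (s\<^sup>2) * w (-\<zeta>) + 1)) + 1 / of_real (2 * s)
    = w \<zeta> * (1 - (of_real s)^4) / (2 * of_real s * (of_real s^2 * w \<zeta> + 1) * (w \<zeta> + of_real s^2))"
  proof -
    have alg: "- (1/2) * (\<sigma> * \<omega> / (\<sigma>\<^sup>2 * \<omega> + 1)) + (1/2) * (- \<sigma> / (\<omega> + \<sigma>\<^sup>2)) + 1 / (2 * \<sigma>)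
        = \<omega> * (1 - \<sigma> ^ 4) / (2 * \<sigma> * (\<sigma>\<^sup>2 * \<omega> + 1) * (\<omega> + \<sigma>\<^sup>2))"
      if "\<sigma> \<noteq> 0" "\<sigma>\<^sup>2 * \<omega> + 1 \<noteq> 0" "\<omega> + \<sigma>\<^sup>2 \<noteq> 0" for \<sigma> \<omega> :: complex
    proof -
      have "- (1/2) * (\<sigma> * \<omega> / u) + (1/2) * (- \<sigma> / v) + 1 / (2 * \<sigma>) = (u * v - \<sigma>\<^sup>2 * \<omega> * v - \<sigma>\<^sup>2 * u) / (2 * \<sigma> * u * v)"
        if "u \<noteq> 0" "v \<noteq> 0" for u v
        using that \<open>\<sigma> \<noteq> 0\<close> by (simp add: field_simps power2_eq_square)
      from this[OF that(2,3)] show ?thesis by (simp add: algebra_simps power4_eq_xxxx power2_eq_square)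
    qed
    have e2: "(of_real (s\<^sup>2) * - (w (-\<zeta>) / of_real s)) / (of_real (s\<^sup>2) * w (-\<zeta>) + 1)
       = - of_real s / (w \<zeta> + of_real s^2)"
      using ne ne2 s0 by (simp add: w_uminus field_simps power2_eq_square)
    have e1: "(of_real (s\<^sup>2) * (w \<zeta> / of_real s)) / (of_real (s\<^sup>2) * w \<zeta> + 1) = of_real s * w \<zeta> / (of_real s ^ 2 * w \<zeta> + 1)"
      using s0 by (simp add: power2_eq_square)
    show ?thesis unfolding e1 e2 using alg[OF s0 ne(1) ne2] by simp
  qed
  ultimately show ?thesis by simp
qed

lemma has_derivative_slope:
  assumes "\<zeta> \<in> strip"
  shows "(slope has_field_derivative slope \<zeta> *
     (w \<zeta> * (1 - (of_real s)^4) / (2 * of_real s * (of_real s^2 * w \<zeta> + 1) * (w \<zeta> + of_real s^2)))) (at \<zeta>)"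
  unfolding slope_def by (rule DERIV_chain2[OF DERIV_exp has_derivative_phi[OF assms]])

lemma convex_strip: "convex strip"
proof -
  have "strip = {\<zeta>. Im \<zeta> < pi * s} \<inter> {\<zeta>. - (pi * s) < Im \<zeta>}" by (auto simp: strip_def)
  then show ?thesis by (simp add: convex_Int convex_halfspace_Im_lt convex_halfspace_Im_gt)
qed

lemma slope_0: "slope 0 = 1" by (simp add: slope_def scherk_phi_eq)

text \<open>If \<open>t\<close> were purely imaginary, \<open>t\<^sup>2\<close> and with it \<open>w\<close> would be real and not positive, which does not happen in
  the open strip. As the strip is connected and \<open>t = 1\<close> at the origin, the real part stays positive.\<close>

lemma Re_slope_pos:
  assumes "\<zeta> \<in> strip" shows "0 < Re (slope \<zeta>)"
proof (rule ccontr)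
  assume c: "\<not> 0 < Re (slope \<zeta>)"
  have "continuous_on strip slope"
    by (meson has_derivative_slope DERIV_isCont continuous_at_imp_continuous_on)
  then have conn: "connected ((\<lambda>x. Re (slope x)) ` strip)"
    by (intro connected_continuous_image continuous_on_Re convex_connected convex_strip)
  have "0 \<in> strip" using s_pos by (simp add: strip_def)
  then have "1 \<in> (\<lambda>x. Re (slope x)) ` strip" using slope_0 by force
  moreover have "Re (slope \<zeta>) \<in> (\<lambda>x. Re (slope x)) ` strip" using assms by simp
  ultimately have "{Re (slope \<zeta>)..1} \<subseteq> (\<lambda>x. Re (slope x)) ` strip"
    using conn by (intro connected_contains_Icc)
  then have "0 \<in> (\<lambda>x. Re (slope x)) ` strip" using c by force
  then obtain \<eta> where h: "\<eta> \<in> strip" "Re (slope \<eta>) = 0" by force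
  define y where "y = (Im (slope \<eta>))\<^sup>2"
  have t2: "(slope \<eta>)\<^sup>2 = - of_real y" using h(2) by (simp add: y_def complex_eq_iff power2_eq_square)
  have "w \<eta> = of_real ((- y - s\<^sup>2) / (1 + s\<^sup>2 * y))"
    using slope_identities(4)[OF h(1)] unfolding t2 by simp
  moreover have "(- y - s\<^sup>2) / (1 + s\<^sup>2 * y) \<le> 0"
    by (intro divide_nonpos_nonneg) (auto simp: y_def)
  ultimately have "w \<eta> \<in> \<real>\<^sub>\<le>\<^sub>0" by (simp only: nonpos_Reals_of_real_iff)
  then show False using w_slit[OF h(1)] by simp
qed

text \<open>The primitive of \<open>t d\<zeta>\<close>, as a rational integral in \<open>t\<close>: with \<open>w = (t\<^sup>2 - s\<^sup>2) / (1 - s\<^sup>2 t\<^sup>2)\<close> and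
  \<open>d\<zeta> = s dw / w\<close> the integrand is \<open>2 s\<^sup>3 / (t\<^sup>2 - s\<^sup>2) + 2 s / (1 - s\<^sup>2 t\<^sup>2)\<close>.\<close>

definition Phi_of_slope :: "complex \<Rightarrow> complex" where
  "Phi_of_slope z = of_real (s\<^sup>2) * Ln ((z - of_real s) / (z + of_real s)) + Ln ((1 + of_real s * z) / (1 - of_real s * z))"

text \<open>If one of the two quotients is real and not positive then \<open>t\<close> is real with \<open>t \<le> s\<close> or \<open>t \<ge> 1 / s\<close>, and
  then \<open>w\<close> would be real and not positive.\<close>

lemma cayley_slits:
  assumes "0 < Re z" and ne: "1 - (of_real s)\<^sup>2 * z\<^sup>2 \<noteq> 0"
    and v: "(z\<^sup>2 - (of_real s)\<^sup>2) / (1 - (of_real s)\<^sup>2 * z\<^sup>2) \<notin> \<real>\<^sub>\<le>\<^sub>0"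
  shows "(z - of_real s) / (z + of_real s) \<notin> \<real>\<^sub>\<le>\<^sub>0" "(1 + of_real s * z) / (1 - of_real s * z) \<notin> \<real>\<^sub>\<le>\<^sub>0"
proof -
  have real: False if "z = of_real x" "x \<le> s \<or> 1 \<le> s * x" for x
  proof -
    have "0 < x" using assms(1) that by simp
    have "(x\<^sup>2 - s\<^sup>2) / (1 - s\<^sup>2 * x\<^sup>2) \<le> 0"
    proof (cases "x \<le> s")
      case True
      then have "x\<^sup>2 \<le> s\<^sup>2" using \<open>0 < x\<close> by (intro power_mono) auto
      moreover have "s\<^sup>2 * x\<^sup>2 \<le> 1 * 1" using s2 calculation by (intro mult_mono) auto
      ultimately show ?thesis by (intro divide_nonpos_nonneg) auto
    next
      case False
      then have "1 \<le> s * x" using that by simp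
      then have "1 \<le> s\<^sup>2 * x\<^sup>2" unfolding power_mult_distrib[symmetric] by (rule one_le_power)
      moreover have "s\<^sup>2 \<le> x\<^sup>2" using False s_pos by (intro power_mono) auto
      ultimately show ?thesis by (intro divide_nonneg_nonpos) auto
    qed
    then have "complex_of_real ((x\<^sup>2 - s\<^sup>2) / (1 - s\<^sup>2 * x\<^sup>2)) \<in> \<real>\<^sub>\<le>\<^sub>0"
      by (simp only: nonpos_Reals_of_real_iff)
    then show False using v that by simp
  qed
  show "(z - of_real s) / (z + of_real s) \<notin> \<real>\<^sub>\<le>\<^sub>0"
  proof
    assume "(z - of_real s) / (z + of_real s) \<in> \<real>\<^sub>\<le>\<^sub>0"
    then obtain r where r: "(z - of_real s) / (z + of_real s) = of_real r" "r \<le> 0"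
      by (auto simp: nonpos_Reals_def)
    have "z + of_real s \<noteq> 0" using assms(1) s_pos by (auto simp: complex_eq_iff)
    then have e: "z - of_real s = of_real r * (z + of_real s)" using r by (simp add: field_simps)
    then have "Im z = r * Im z" "Re z - s = r * (Re z + s)" by (auto simp: complex_eq_iff)
    then have "Im z * (1 - r) = 0" "Re z - s = r * (Re z + s)" by (auto simp: algebra_simps)
    moreover have "r * (Re z + s) \<le> 0" using r assms(1) s_pos by (simp add: mult_nonpos_nonneg)
    ultimately have "z = of_real (Re z)" "Re z \<le> s" using r by (auto simp: complex_eq_iff)
    then show False using real by blast
  qed
  show "(1 + of_real s * z) / (1 - of_real s * z) \<notin> \<real>\<^sub>\<le>\<^sub>0"
  proof
    assume "(1 + of_real s * z) / (1 - of_real s * z) \<in> \<real>\<^sub>\<le>\<^sub>0"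
    then obtain r where r: "(1 + of_real s * z) / (1 - of_real s * z) = of_real r" "r \<le> 0"
      by (auto simp: nonpos_Reals_def)
    have "1 - of_real s * z \<noteq> 0"
    proof
      assume "1 - of_real s * z = 0"
      then have "of_real s * z = 1" by simp
      then have "(of_real s * z)\<^sup>2 = 1" by simp
      then show False using ne by (simp add: power_mult_distrib)
    qed
    then have "1 + of_real s * z = of_real r * (1 - of_real s * z)" using r by (simp add: field_simps)
    then have e: "s * Im z * (1 + r) = 0" "1 + s * Re z = r * (1 - s * Re z)"
      by (auto simp: complex_eq_iff algebra_simps)
    have p: "0 < s * Re z" using assms(1) s_pos by simp
    have "r \<noteq> -1" using e(2) by auto
    then have "Im z = 0" using e(1) s_pos by auto
    moreover have "1 \<le> s * Re z"
    proof (rule ccontr)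
      assume "\<not> 1 \<le> s * Re z"
      then have "r * (1 - s * Re z) \<le> 0" using r by (simp add: mult_nonpos_nonneg)
      then show False using e(2) p by simp
    qed
    ultimately show False using real[of "Re z"] by (auto simp: complex_eq_iff)
  qed
qed

lemma has_derivative_Phi_of_slope:
  assumes "(z - of_real s) / (z + of_real s) \<notin> \<real>\<^sub>\<le>\<^sub>0" "(1 + of_real s * z) / (1 - of_real s * z) \<notin> \<real>\<^sub>\<le>\<^sub>0"
  shows "(Phi_of_slope has_field_derivative
     2 * of_real s^3 / (z\<^sup>2 - (of_real s)\<^sup>2) + 2 * of_real s / (1 - (of_real s)\<^sup>2 * z\<^sup>2)) (at z)"
proof -
  have ne: "z - of_real s \<noteq> 0" "z + of_real s \<noteq> 0" "1 + of_real s * z \<noteq> 0" "1 - of_real s * z \<noteq> 0"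
    using assms by auto
  have f1: "z\<^sup>2 - (of_real s)\<^sup>2 = (z - of_real s) * (z + of_real s)"
    by (simp add: power2_eq_square algebra_simps)
  have f2: "1 - (of_real s)\<^sup>2 * z\<^sup>2 = (1 + of_real s * z) * (1 - of_real s * z)"
    by (simp add: power2_eq_square algebra_simps)
  have d1: "((\<lambda>z. (z - of_real s) / (z + of_real s)) has_field_derivative 2 * of_real s / (z + of_real s)^2) (at z)"
    using ne by (auto intro!: derivative_eq_intros simp: power2_eq_square)
  have d2: "((\<lambda>z. (1 + of_real s * z) / (1 - of_real s * z)) has_field_derivative 2 * of_real s / (1 - of_real s * z)^2) (at z)"
    using ne by (auto intro!: derivative_eq_intros simp: power2_eq_square algebra_simps)
  have "(Phi_of_slope has_field_derivative of_real (s\<^sup>2) * (inverse ((z - of_real s) / (z + of_real s)) * (2 * of_real s / (z + of_real s)^2))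
     + inverse ((1 + of_real s * z) / (1 - of_real s * z)) * (2 * of_real s / (1 - of_real s * z)^2)) (at z)"
    unfolding Phi_of_slope_def
    by (intro DERIV_add DERIV_cmult DERIV_chain2[OF has_field_derivative_Ln d1] DERIV_chain2[OF has_field_derivative_Ln d2] assms)
  moreover have frac: "x\<^sup>2 * (inverse (c / d) * (2 * x / d\<^sup>2)) = 2 * x ^ 3 / (c * d)" if "c \<noteq> 0" "d \<noteq> 0" for c d x :: complex
  proof -
    have "inverse (c / d) * (2 * x / d\<^sup>2) = 2 * x / (c * d)"
      using that by (simp add: power2_eq_square)
    then show ?thesis by (simp add: power2_eq_square power3_eq_cube)
  qed
  moreover have "of_real (s\<^sup>2) * (inverse ((z - of_real s) / (z + of_real s)) * (2 * of_real s / (z + of_real s)^2))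
     = 2 * of_real s^3 / (z\<^sup>2 - (of_real s)\<^sup>2)"
    unfolding f1 of_real_power using ne by (intro frac)
  moreover have "inverse ((1 + of_real s * z) / (1 - of_real s * z)) * (2 * of_real s / (1 - of_real s * z)^2)
     = 2 * of_real s / (1 - (of_real s)\<^sup>2 * z\<^sup>2)"
    unfolding f2 using ne by (simp add: power2_eq_square)
  ultimately show ?thesis by simp
qed

lemma slope_slits:
  assumes "\<zeta> \<in> strip"
  shows "(slope \<zeta> - of_real s) / (slope \<zeta> + of_real s) \<notin> \<real>\<^sub>\<le>\<^sub>0" "(1 + of_real s * slope \<zeta>) / (1 - of_real s * slope \<zeta>) \<notin> \<real>\<^sub>\<le>\<^sub>0"
  using cayley_slits[OF Re_slope_pos[OF assms] slope_identities(3)[OF assms]] w_slit[OF assms]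
  unfolding slope_identities(4)[OF assms, symmetric] by auto

text \<open>In terms of \<open>w\<close>, the derivative of the primitive with respect to \<open>t\<close> is the reciprocal of \<open>\<phi>'\<close>, while
  \<open>t' = t \<phi>'\<close>.\<close>

lemma has_derivative_Phi_slope:
  assumes "\<zeta> \<in> strip"
  shows "((\<lambda>\<zeta>. Phi_of_slope (slope \<zeta>)) has_field_derivative slope \<zeta>) (at \<zeta>)"
proof -
  let ?s = "complex_of_real s" and ?w = "w \<zeta>"
  have ne: "?s ^ 2 * w \<zeta> + 1 \<noteq> 0" "?s ^ 2 * w (-\<zeta>) + 1 \<noteq> 0"
    using affine_w_slit[OF assms] by (metis nonpos_Reals_zero_I of_real_power)+
  have ne2: "w \<zeta> + ?s ^ 2 \<noteq> 0" using ne(2) by (simp add: w_uminus field_simps)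
  have s0: "?s \<noteq> 0" using s_pos by simp
  have s4: "1 - ?s ^ 4 \<noteq> 0" using s4_ne by simp
  have "2 * ?s^3 / ((slope \<zeta>)\<^sup>2 - ?s\<^sup>2) + 2 * ?s / (1 - ?s\<^sup>2 * (slope \<zeta>)\<^sup>2)
     = 2 * ?s * (?s\<^sup>2 * ?w + 1) * (?w + ?s\<^sup>2) / (?w * (1 - ?s^4))"
    unfolding slope_identities(1,2)[OF assms] using s4 ne(1)
    by (simp add: divide_simps) (simp add: algebra_simps power2_eq_square power3_eq_cube)
  moreover have "\<dots> * (slope \<zeta> * (?w * (1 - ?s^4) / (2 * ?s * (?s^2 * ?w + 1) * (?w + ?s^2)))) = slope \<zeta>"
    using s4 ne(1) ne2 s0 by simp
  ultimately show ?thesis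
    using DERIV_chain2[OF has_derivative_Phi_of_slope[OF slope_slits[OF assms]] has_derivative_slope[OF assms]] by simp
qed

lemma scherk_primitive_eq:
  assumes "\<zeta> \<in> strip" shows "scherk_primitive s \<zeta> = Phi_of_slope (slope \<zeta>) - Phi_of_slope 1"
proof -
  have "0 \<in> strip" using s_pos by (simp add: strip_def)
  then have "path_image (linepath 0 \<zeta>) \<subseteq> strip"
    using assms convex_strip by (simp add: closed_segment_subset)
  then have "(slope has_contour_integral (Phi_of_slope (slope (pathfinish (linepath 0 \<zeta>))) - Phi_of_slope (slope (pathstart (linepath 0 \<zeta>))))) (linepath 0 \<zeta>)"
    by (intro contour_integral_primitive[of strip "\<lambda>\<zeta>. Phi_of_slope (slope \<zeta>)"])
       (auto intro: has_field_derivative_at_within has_derivative_Phi_slope)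
  then show ?thesis
    unfolding scherk_primitive_def slope_def[symmetric] by (simp add: contour_integral_unique slope_0)
qed

section \<open>The additive constant\<close>

text \<open>The corners of the half-strip are \<open>corner 1\<close> and \<open>corner (-1)\<close>.\<close>

definition corner :: "real \<Rightarrow> complex" where "corner e = \<i> * of_real (e * (pi * s))"

lemma w_corner:
  assumes "\<bar>e\<bar> = 1" shows "w (corner e) = -1" "w (- corner e) = -1"
proof -
  have "w (corner e) = exp (\<i> * of_real pi * of_real e)" for e
    unfolding w_def corner_def using s_pos by (simp add: mult_ac)
  moreover have "- corner e = corner (- e)" by (simp add: corner_def)
  moreover have "e = 1 \<or> e = -1" using assms by linarith
  ultimately show "w (corner e) = -1" "w (- corner e) = -1"
    by (auto simp: exp_minus)
qed

lemma slope_corner: "\<bar>e\<bar> = 1 \<Longrightarrow> slope (corner e) = \<i> * of_real e"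
proof -
  assume e: "\<bar>e\<bar> = 1"
  have "scherk_phi s (corner e) = corner e / of_real (2 * s)"
    unfolding scherk_phi_eq w_corner[OF e] by simp
  also have "\<dots> = \<i> * of_real (e * pi / 2)" using s_pos by (simp add: corner_def)
  finally have "slope (corner e) = cis (e * pi / 2)" by (simp only: slope_def cis_conv_exp)
  moreover have "e = 1 \<or> e = -1" using e by linarith
  ultimately show ?thesis by (auto simp: complex_eq_iff)
qed

lemma continuous_w: "isCont w x"
  unfolding w_def using s_pos by (intro continuous_intros) auto

lemma isCont_slope_corner:
  assumes "\<bar>e\<bar> = 1" shows "isCont slope (corner e)"
proof -
  have slit: "of_real (s\<^sup>2) * (-1) + 1 \<notin> (\<real>\<^sub>\<le>\<^sub>0 :: complex set)"
    using affine_slit[of "-1"] s2 by (auto simp: complex_nonpos_Reals_iff simp del: of_real_power)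
  have c: "isCont (\<lambda>x. w (- x)) (corner e)"
    by (rule isCont_o2[OF _ continuous_w]) (intro continuous_intros)
  have "isCont (scherk_phi s) (corner e)"
    unfolding scherk_phi_eq[abs_def]
    by (intro continuous_intros isCont_Ln' c continuous_w) (use s_pos slit w_corner[OF assms] in auto)
  then show ?thesis unfolding slope_def by (intro continuous_intros)
qed

text \<open>Numerator and denominator of each quotient have equal modulus when \<open>t = \<plusminus>\<i>\<close>, so the real parts of
  both logarithms vanish. This determines the additive constant.\<close>

lemma Phi_of_slope_corner:
  assumes "\<bar>e\<bar> = 1"
  shows "isCont Phi_of_slope (\<i> * of_real e)" "Re (Phi_of_slope (\<i> * of_real e)) = 0"
proof -
  let ?z = "\<i> * complex_of_real e"
  have e: "e\<^sup>2 = 1" "e \<noteq> 0" using assms by (auto simp: abs_square_eq_1)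
  let ?a = "(?z - of_real s) / (?z + of_real s)" and ?b = "(1 + of_real s * ?z) / (1 - of_real s * ?z)"
  have n: "cmod (?z - of_real s) = cmod (?z + of_real s)" "cmod (1 + of_real s * ?z) = cmod (1 - of_real s * ?z)"
    by (simp_all add: cmod_def)
  have ne: "?z + of_real s \<noteq> 0" "1 - of_real s * ?z \<noteq> 0" using s_pos e by (auto simp: complex_eq_iff)
  have ab: "cmod ?a = 1" "cmod ?b = 1" unfolding norm_divide n using ne by auto
  have "s\<^sup>2 \<noteq> - 1" "(s * e)\<^sup>2 \<noteq> - 1"
    using zero_le_power2[of s] zero_le_power2[of "s * e"] by linarith+
  then have "Im ?a \<noteq> 0" "Im ?b \<noteq> 0" 
    using s_pos e by (auto simp: Im_divide power2_eq_square[symmetric] add_eq_0_iff2 sum_power2_eq_zero_iff)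
  then have slits: "?a \<notin> \<real>\<^sub>\<le>\<^sub>0" "?b \<notin> \<real>\<^sub>\<le>\<^sub>0" by (auto simp: complex_nonpos_Reals_iff)
  show "isCont Phi_of_slope ?z" by (rule DERIV_isCont[OF has_derivative_Phi_of_slope[OF slits]])
  have "?a \<noteq> 0" "?b \<noteq> 0" using ab by auto
  then show "Re (Phi_of_slope ?z) = 0" unfolding Phi_of_slope_def using ab by (simp add: Re_Ln del: of_real_power)
qed

lemma primitive_at_corner:
  assumes "\<bar>e\<bar> = 1"
  shows "((\<lambda>\<zeta>. Re (scherk_primitive s \<zeta> + of_real c)) \<longlongrightarrow> c - Re (Phi_of_slope 1)) (at (corner e) within half_strip (scherk_l s))"
proof -
  have "isCont (\<lambda>\<zeta>. Phi_of_slope (slope \<zeta>)) (corner e)"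
    using isCont_o2[OF isCont_slope_corner[OF assms]] Phi_of_slope_corner(1)[OF assms] slope_corner[OF assms] by simp
  then have "((\<lambda>\<zeta>. Phi_of_slope (slope \<zeta>)) \<longlongrightarrow> Phi_of_slope (\<i> * of_real e)) (at (corner e) within half_strip (scherk_l s))"
    using slope_corner[OF assms] by (auto simp: isCont_def intro: tendsto_within_subset)
  then have "((\<lambda>\<zeta>. Re (Phi_of_slope (slope \<zeta>) - Phi_of_slope 1 + of_real c)) \<longlongrightarrow> Re (Phi_of_slope (\<i> * of_real e) - Phi_of_slope 1 + of_real c))
     (at (corner e) within half_strip (scherk_l s))"
    by (intro tendsto_intros)
  then have "((\<lambda>\<zeta>. Re (Phi_of_slope (slope \<zeta>) - Phi_of_slope 1 + of_real c)) \<longlongrightarrow> c - Re (Phi_of_slope 1)) (at (corner e) within half_strip (scherk_l s))"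
    using Phi_of_slope_corner(2)[OF assms] by simp
  moreover have "\<forall>\<^sub>F \<zeta> in at (corner e) within half_strip (scherk_l s).
      Re (Phi_of_slope (slope \<zeta>) - Phi_of_slope 1 + of_real c) = Re (scherk_primitive s \<zeta> + of_real c)"
    unfolding eventually_at_filter using half_strip_subset by (auto simp: scherk_primitive_eq intro!: always_eventually)
  ultimately show ?thesis by (rule Lim_transform_eventually)
qed

lemma corner_islimpt:
  assumes "\<bar>e\<bar> = 1" shows "corner e islimpt half_strip (scherk_l s)"
  unfolding islimpt_approachable
proof (intro allI impI)
  fix d :: real assume "0 < d"
  define h where "h = min d (pi * s) / 3"
  have h: "0 < h" "2 * h < d" "h < pi * s" using \<open>0 < d\<close> s_pos by (auto simp: h_def min_def)
  have e: "e = 1 \<or> e = -1" using assms by linarith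
  let ?x = "Complex h (e * (pi * s - h))"
  have "?x - corner e = Complex h (- e * h)" by (simp add: corner_def complex_eq_iff algebra_simps)
  then have "dist ?x (corner e) \<le> \<bar>h\<bar> + \<bar>e * h\<bar>"
    using cmod_le[of "Complex h (- e * h)"] by (simp add: dist_norm)
  also have "\<dots> < d" using h e by auto
  finally have "dist ?x (corner e) < d" .
  moreover have "?x \<in> half_strip (scherk_l s)" using h e s_pos by (auto simp: half_strip_eq strip_def)
  moreover have "?x \<noteq> corner e" using h by (simp add: corner_def complex_eq_iff)
  ultimately show "\<exists>x'\<in>half_strip (scherk_l s). x' \<noteq> corner e \<and> dist x' (corner e) < d" by blast
qed

lemma scherk_c_eq: "scherk_c s = Re (Phi_of_slope 1)"
proof -
  have corners: "{\<i> * of_real (scherk_l s / 2), - \<i> * of_real (scherk_l s / 2)} = {corner 1, corner (-1)}"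
    by (simp add: corner_def scherk_l_def)
  show ?thesis unfolding scherk_c_def corners
  proof (rule the_equality)
    show "\<forall>p\<in>{corner 1, corner (- 1)}. ((\<lambda>\<zeta>. Re (scherk_primitive s \<zeta> + of_real (Re (Phi_of_slope 1)))) \<longlongrightarrow> 0) (at p within half_strip (scherk_l s))"
      using primitive_at_corner[of 1 "Re (Phi_of_slope 1)"] primitive_at_corner[of "-1" "Re (Phi_of_slope 1)"] by simp
    fix c assume "\<forall>p\<in>{corner 1, corner (- 1)}. ((\<lambda>\<zeta>. Re (scherk_primitive s \<zeta> + of_real c)) \<longlongrightarrow> 0) (at p within half_strip (scherk_l s))"
    then have "((\<lambda>\<zeta>. Re (scherk_primitive s \<zeta> + of_real c)) \<longlongrightarrow> 0) (at (corner 1) within half_strip (scherk_l s))" by simp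
    moreover have "at (corner 1) within half_strip (scherk_l s) \<noteq> bot"
      using corner_islimpt[of 1] by (simp add: trivial_limit_within)
    ultimately have "c - Re (Phi_of_slope 1) = 0" using primitive_at_corner[of 1 c] tendsto_unique by force
    then show "c = Re (Phi_of_slope 1)" by simp
  qed
qed

lemma Phi_of_slope_1_real: "of_real (Re (Phi_of_slope 1)) = Phi_of_slope 1"
proof -
  have "Phi_of_slope 1 = of_real (s\<^sup>2) * Ln (of_real ((1 - s) / (1 + s))) + Ln (of_real ((1 + s) / (1 - s)))"
    by (simp add: Phi_of_slope_def)
  also have "\<dots> = of_real (s\<^sup>2 * ln ((1 - s) / (1 + s)) + ln ((1 + s) / (1 - s)))"
    using s_pos s_less_1 by (simp add: Ln_of_real del: of_real_divide of_real_add of_real_diff of_real_power) simp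
  finally show ?thesis by (metis Re_complex_of_real)
qed

lemma scherk_Phi_eq: "\<zeta> \<in> strip \<Longrightarrow> scherk_Phi s \<zeta> = Phi_of_slope (slope \<zeta>)"
  by (simp add: scherk_Phi_def scherk_primitive_eq scherk_c_eq Phi_of_slope_1_real)

section \<open>The half-strip in the flat coordinate\<close>

text \<open>The coordinate \<open>q\<close> attached to a point of the half-strip; the free boundary has a simple equation in it.\<close>

definition flat :: "complex \<Rightarrow> complex" where
  "flat \<zeta> = Ln ((1 + of_real s * slope \<zeta>) / (1 - of_real s * slope \<zeta>))"

lemma ratio_W_of_cayley:
  assumes E: "exp p = (1 + of_real s * z) / (1 - of_real s * z)" and ne: "1 - of_real s * z \<noteq> 0"
  shows "ratio p = (z - of_real s) / (z + of_real s)"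
    and "W p = (z\<^sup>2 - (of_real s)\<^sup>2) / (1 - (of_real s)\<^sup>2 * z\<^sup>2)"
proof -
  let ?s = "complex_of_real s"
  have s0: "?s \<noteq> 0" using s_pos by simp
  have ne': "1 + ?s * z \<noteq> 0" using E by (metis divide_eq_0_iff exp_not_eq_zero)
  have n: "of_real A * exp p - of_real B = 2 * ?s * (z - ?s) / (1 - ?s * z)"
    unfolding E AB_of_real using ne by (simp add: field_simps power2_eq_square)
  have d: "of_real B * exp p - of_real A = 2 * ?s * (z + ?s) / (1 - ?s * z)"
    unfolding E AB_of_real using ne by (simp add: field_simps power2_eq_square)
  show "ratio p = (z - ?s) / (z + ?s)" unfolding ratio_def n d using ne s0 by simp
  have "W p = (z - ?s) * (z + ?s) / ((1 + ?s * z) * (1 - ?s * z))"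
    unfolding W_def n d unfolding AB_of_real E using ne ne' s0 by (simp add: power2_eq_square)
  also have "(z - ?s) * (z + ?s) = z\<^sup>2 - ?s\<^sup>2" by (simp add: power2_eq_square algebra_simps)
  also have "(1 + ?s * z) * (1 - ?s * z) = 1 - ?s\<^sup>2 * z\<^sup>2" by (simp add: power2_eq_square algebra_simps)
  finally show "W p = (z\<^sup>2 - ?s\<^sup>2) / (1 - ?s\<^sup>2 * z\<^sup>2)" .
qed

lemma cayley_denominator: "\<zeta> \<in> strip \<Longrightarrow> 1 - of_real s * slope \<zeta> \<noteq> 0"
  using slope_slits(2)[of \<zeta>] by auto

lemma exp_flat:
  assumes "\<zeta> \<in> strip" shows "exp (flat \<zeta>) = (1 + of_real s * slope \<zeta>) / (1 - of_real s * slope \<zeta>)"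
proof -
  have "(1 + of_real s * slope \<zeta>) / (1 - of_real s * slope \<zeta>) \<noteq> 0"
    using slope_slits(2)[OF assms] by (metis nonpos_Reals_zero_I)
  then show ?thesis unfolding flat_def by (rule exp_Ln)
qed

lemma W_flat: "\<zeta> \<in> strip \<Longrightarrow> W (flat \<zeta>) = w \<zeta>"
  using ratio_W_of_cayley(2)[OF exp_flat cayley_denominator] slope_identities(4) by simp

lemma level_flat_pos:
  assumes "\<zeta> \<in> half_strip (scherk_l s)" shows "0 < level (flat \<zeta>)"
proof -
  have z: "\<zeta> \<in> strip" "0 < Re \<zeta>" using assms by (auto simp: half_strip_eq)
  then have "1 < cmod (w \<zeta>)" using s_pos by (simp add: w_def)
  then show ?thesis using W_flat[OF z(1)] norm_W_less[of "flat \<zeta>"] by simp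
qed

lemma G_flat:
  assumes "\<zeta> \<in> half_strip (scherk_l s)" shows "G (flat \<zeta>) = scherk_Phi s \<zeta>"
proof -
  have z: "\<zeta> \<in> strip" using assms by (auto simp: half_strip_eq)
  have "ratio (flat \<zeta>) = (slope \<zeta> - of_real s) / (slope \<zeta> + of_real s)"
    by (rule ratio_W_of_cayley(1)[OF exp_flat[OF z] cayley_denominator[OF z]])
  then show ?thesis using level_flat_pos[OF assms]
    by (simp add: G_def displacement_def scherk_Phi_eq[OF z] Phi_of_slope_def flat_def)
qed

lemma inj_on_Phi: "inj_on (scherk_Phi s) (half_strip (scherk_l s))"
proof (rule inj_onI)
  fix x y assume xy: "x \<in> half_strip (scherk_l s)" "y \<in> half_strip (scherk_l s)" "scherk_Phi s x = scherk_Phi s y"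
  then have "G (flat x) = G (flat y)" by (simp add: G_flat)
  then have "flat x = flat y" using bij_G by (simp add: bij_is_inj inj_eq)
  moreover have st: "x \<in> strip" "y \<in> strip" using xy by (auto simp: half_strip_eq)
  ultimately have "w x = w y" using W_flat by metis
  moreover have "Ln (w x) = x / of_real s" if "x \<in> strip" for x
  proof -
    have "- pi < Im x / s" "Im x / s < pi"
      using that s_pos by (auto simp: strip_def field_simps abs_less_iff)
    then show ?thesis unfolding w_def by (intro Ln_exp) auto
  qed
  ultimately show "x = y" using st s_pos by (metis divide_cancel_right of_real_eq_0_iff less_irrefl)
qed

lemma Re_of_real_mult: "Re (of_real x * z) = x * Re z"
  and Im_of_real_mult: "Im (of_real x * z) = x * Im z"
  by simp_all

text \<open>A real value of \<open>W\<close> below \<open>-1\<close> would force \<open>cosh p\<close> to be real and below \<open>A / B < 1\<close>, but \<open>cosh\<close> is at least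
  one where it is real in the open half-strip.\<close>

lemma W_slit:
  assumes "0 < level p" "p \<in> half_strip (2 * pi)" shows "W p \<notin> \<real>\<^sub>\<le>\<^sub>0"
proof
  assume "W p \<in> \<real>\<^sub>\<le>\<^sub>0"
  then obtain r where r: "W p = of_real r" "r \<le> 0" by (auto simp: nonpos_Reals_def)
  have "1 < \<bar>r\<bar>" using norm_W_less[of p] assms(1) r by simp
  then have r1: "r < -1" using r by simp
  have p: "0 < Re p" "\<bar>Im p\<bar> < pi" using assms(2) by (auto simp: half_strip_def)
  have "complex_of_real (B - A) \<noteq> 0" using AB(2) by (simp del: of_real_diff)
  then have "W p * of_real (B - A) = of_real (A * B) * cosh p - complex_of_real ((A\<^sup>2 + B\<^sup>2) / 2)"
    unfolding W_cosh by (rule nonzero_eq_divide_eq[THEN iffD1]) (rule refl)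
  then have "of_real (A * B) * cosh p - complex_of_real ((A\<^sup>2 + B\<^sup>2) / 2) = of_real r * of_real (B - A)"
    unfolding r(1) by (rule sym)
  then have cosh_p: "of_real (A * B) * cosh p = complex_of_real ((B - A) * r + (A\<^sup>2 + B\<^sup>2) / 2)"
    unfolding diff_eq_eq by (simp add: mult.commute)
  have c: "A * B * (cosh (Re p) * cos (Im p)) = (B - A) * r + (A\<^sup>2 + B\<^sup>2) / 2" "A * B * (sinh (Re p) * sin (Im p)) = 0"
    using arg_cong[OF cosh_p, of Re] arg_cong[OF cosh_p, of Im]
    by (simp_all only: Re_complex_of_real Im_complex_of_real Re_of_real_mult Im_of_real_mult cosh_Re_Im)
  have "A * B * sinh (Re p) \<noteq> 0" using AB p(1) by simp
  then have "sin (Im p) = 0" using c(2) by (metis mult.assoc mult_eq_0_iff)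
  then have "Im p = 0" using p(2) by (simp only: sin_zero_pi_iff)
  then have "A * B * cosh (Re p) = (B - A) * r + (A\<^sup>2 + B\<^sup>2) / 2" using c(1) by simp
  also have "\<dots> < (B - A) * (-1) + (A\<^sup>2 + B\<^sup>2) / 2"
    using AB(2) r1 by (intro add_strict_right_mono mult_strict_left_mono) auto
  also have "\<dots> = A\<^sup>2" by (simp add: A_def B_def power2_eq_square field_simps)
  also have "\<dots> < A * B" using AB(1,2) by (simp add: power2_eq_square)
  finally have "A * B * cosh (Re p) < A * B * 1" by simp
  moreover have "A * B * 1 \<le> A * B * cosh (Re p)" using AB by (intro mult_left_mono cosh_real_ge_1) auto
  ultimately show False by simp
qed

text \<open>The candidate is \<open>\<zeta> = s Ln (W p)\<close>. Its slope \<open>t\<close> and the value \<open>x\<close> with \<open>exp p = (1 + s x) / (1 - s x)\<close> give the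
  same \<open>w\<close>, hence have equal squares, and both have positive real part.\<close>

lemma flat_surj:
  assumes "0 < level p" "p \<in> half_strip (2 * pi)"
  obtains \<zeta> where "\<zeta> \<in> half_strip (scherk_l s)" "flat \<zeta> = p"
proof
  let ?s = "complex_of_real s"
  define \<zeta> where "\<zeta> = ?s * Ln (W p)"
  have W0: "W p \<noteq> 0" using W_slit[OF assms] by (metis nonpos_Reals_zero_I)
  have "0 < Re \<zeta>" using W0 s_pos norm_W_less[of p] assms(1) by (simp add: \<zeta>_def Re_Ln)
  moreover have "\<bar>Im (Ln (W p))\<bar> < pi"
    using mpi_less_Im_Ln[OF W0] Im_Ln_le_pi[OF W0] Im_Ln_eq_pi[OF W0] W_slit[OF assms]
    by (auto simp: complex_nonpos_Reals_iff abs_less_iff less_le)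
  then have "\<zeta> \<in> strip" using s_pos by (simp add: \<zeta>_def strip_def abs_mult)
  ultimately show "\<zeta> \<in> half_strip (scherk_l s)" by (simp add: half_strip_eq)
  have z: "\<zeta> \<in> strip" by fact
  have wz: "w \<zeta> = W p" unfolding w_def \<zeta>_def using s_pos W0 by simp
  have p: "0 < Re p" "\<bar>Im p\<bar> < pi" using assms(2) by (auto simp: half_strip_def)
  have Ln: "Ln (exp p) = p" using p by (intro Ln_exp) auto
  have E1: "exp p + 1 \<noteq> 0"
  proof
    assume "exp p + 1 = 0"
    then have "exp p = -1" by (simp add: add_eq_0_iff2)
    then have "cmod (exp p) = 1" by simp
    then show False using p by simp
  qed
  define x where "x = (exp p - 1) / (?s * (exp p + 1))"
  have s0: "?s \<noteq> 0" using s_pos by simp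
  have sx: "?s * x = (exp p - 1) / (exp p + 1)" using s0 by (simp add: x_def)
  have dx: "1 - ?s * x = 2 / (exp p + 1)" unfolding sx using E1 by (simp add: field_simps)
  have nx: "1 + ?s * x = 2 * exp p / (exp p + 1)" unfolding sx using E1 by (simp add: field_simps)
  have ex: "exp p = (1 + ?s * x) / (1 - ?s * x)" unfolding dx nx using E1 by simp
  have dx0: "1 - ?s * x \<noteq> 0" unfolding dx using E1 by simp
  have "0 < Re (?s * x)"
  proof -
    have "0 < (cmod (exp p))\<^sup>2 - 1" using p by (simp add: one_less_power)
    also have "\<dots> = Re ((exp p - 1) * cnj (exp p + 1))"
      unfolding cmod_power2 by (simp add: power2_eq_square algebra_simps)
    finally show ?thesis unfolding sx Re_complex_div_gt_0 .
  qed
  then have xpos: "0 < Re x" using s_pos by (simp add: zero_less_mult_iff)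
  have den: "1 - ?s\<^sup>2 * x\<^sup>2 \<noteq> 0"
  proof -
    have "1 - ?s\<^sup>2 * x\<^sup>2 = (1 - ?s * x) * (1 + ?s * x)" by (simp add: power2_eq_square algebra_simps)
    then show ?thesis using dx0 E1 nx by simp
  qed
  have "(x\<^sup>2 - ?s\<^sup>2) / (1 - ?s\<^sup>2 * x\<^sup>2) = ((slope \<zeta>)\<^sup>2 - ?s\<^sup>2) / (1 - ?s\<^sup>2 * (slope \<zeta>)\<^sup>2)"
    using ratio_W_of_cayley(2)[OF ex dx0] slope_identities(4)[OF z] wz by simp
  then have "(x\<^sup>2 - ?s\<^sup>2) * (1 - ?s\<^sup>2 * (slope \<zeta>)\<^sup>2) = ((slope \<zeta>)\<^sup>2 - ?s\<^sup>2) * (1 - ?s\<^sup>2 * x\<^sup>2)"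
    using den slope_identities(3)[OF z] by (simp add: frac_eq_eq)
  then have "(1 - ?s ^ 4) * (x\<^sup>2 - (slope \<zeta>)\<^sup>2) = 0"
    by (simp add: algebra_simps power2_eq_square power4_eq_xxxx)
  then have "x\<^sup>2 = (slope \<zeta>)\<^sup>2" using s4_ne by simp
  then have "x = slope \<zeta> \<or> x = - slope \<zeta>" by (simp add: power2_eq_iff)
  then have "x = slope \<zeta>" using xpos Re_slope_pos[OF z] by auto
  then show "flat \<zeta> = p" unfolding flat_def using ex Ln by simp
qed

section \<open>The Scherk solution\<close>

lemma norm_W_cong:
  assumes "cosh (Re p) = cosh (Re p')" "cos (Im p) = cos (Im p')"
  shows "cmod (W p) = cmod (W p')"
proof -
  have "level p = level p'" using assms by (simp add: level_def)
  then have "(B - A)\<^sup>2 * ((cmod (W p))\<^sup>2 - 1) = (B - A)\<^sup>2 * ((cmod (W p'))\<^sup>2 - 1)"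
    unfolding norm_W assms by simp
  then have "(cmod (W p))\<^sup>2 = (cmod (W p'))\<^sup>2" using AB(2) by (simp only: mult_cancel_left) simp
  then show ?thesis by simp
qed

text \<open>Inside the loop \<open>\<bar>W\<bar> < 1\<close>, so the maximum extends the solution by zero without a case distinction.\<close>

definition height :: "complex \<Rightarrow> real" where
  "height z = s * ln (max 1 (cmod (W (inv G z))))"

lemma inv_G [simp]: "inv G (G p) = p" "G (inv G z) = z"
  using bij_G by (simp_all add: bij_is_inj bij_is_surj surj_f_inv_f)

lemma inv_G_eqI: "G p = z \<Longrightarrow> inv G z = p" by auto

lemma height_pos_iff: "0 < height z \<longleftrightarrow> 0 < level (inv G z)"
proof -
  have "0 < height z \<longleftrightarrow> 0 < ln (max 1 (cmod (W (inv G z))))"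
    unfolding height_def using s_pos by (simp only: zero_less_mult_iff) auto
  also have "\<dots> \<longleftrightarrow> 1 < max 1 (cmod (W (inv G z)))" by (rule ln_gt_zero_iff) simp
  also have "\<dots> \<longleftrightarrow> 0 < level (inv G z)" by (simp add: norm_W_less less_max_iff_disj)
  finally show ?thesis .
qed

lemma continuous_height: "continuous_on UNIV height"
proof -
  have c: "continuous_on UNIV (inv G)" using homeomorphism_G by (simp add: homeomorphism_def)
  have "continuous_on UNIV W" unfolding W_def using AB by (intro continuous_intros) auto
  then have "continuous_on UNIV (\<lambda>z. W (inv G z))" by (rule continuous_on_compose2[OF _ c]) simp
  then show ?thesis unfolding height_def by (intro continuous_intros) (auto simp: max_def)
qed

lemma height_symmetric: "height (- cnj z) = height z" "height (cnj z) = height z" "height (z + 2 * of_real pi * \<i>) = height z"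
proof -
  have i: "inv G (- cnj z) = - cnj (inv G z)" "inv G (cnj z) = cnj (inv G z)"
    "inv G (z + 2 * of_real pi * \<i>) = inv G z + 2 * of_real pi * \<i>"
    by (rule inv_G_eqI, simp add: G_symmetric)+
  show "height (- cnj z) = height z" unfolding height_def i by (subst norm_W_cong[of _ "inv G z"]) auto
  show "height (cnj z) = height z" unfolding height_def i by (subst norm_W_cong[of _ "inv G z"]) auto
  show "height (z + 2 * of_real pi * \<i>) = height z" unfolding height_def i by (subst norm_W_cong[of _ "inv G z"]) auto
qed

lemma G_half_strip_iff: "G p \<in> half_strip (2 * pi) \<longleftrightarrow> p \<in> half_strip (2 * pi)"
  by (simp add: half_strip_def Re_G_pos_iff abs_Im_G_less_iff)

text \<open>Where \<open>level\<close> is positive, the point is \<open>\<Phi> \<zeta>\<close> with \<open>W = exp (\<zeta> / s)\<close>, so that \<open>s ln \<bar>W\<bar> = Re \<zeta>\<close>. Elsewhere it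
  is outside the image of \<open>\<Phi>\<close>, because \<open>G\<close> is injective.\<close>

lemma height_on_strip:
  assumes "z \<in> half_strip (2 * pi)" shows "height z = scherk_on_strip s z"
proof -
  define p where "p = inv G z"
  have z: "z = G p" by (simp add: p_def)
  have p: "p \<in> half_strip (2 * pi)" using assms G_half_strip_iff by (simp add: z)
  show ?thesis
  proof (cases "0 < level p")
    case True
    obtain \<zeta> where \<zeta>: "\<zeta> \<in> half_strip (scherk_l s)" "flat \<zeta> = p" by (rule flat_surj[OF True p])
    have Phi: "scherk_Phi s \<zeta> = z" using G_flat[OF \<zeta>(1)] \<zeta>(2) z by simp
    have "cmod (W p) = exp (Re \<zeta> / s)"
      using W_flat[of \<zeta>] \<zeta> by (simp add: half_strip_eq w_def)
    moreover have "0 < Re \<zeta> / s" using \<zeta>(1) s_pos by (simp add: half_strip_eq)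
    ultimately have "height z = Re \<zeta>" using s_pos by (simp add: height_def p_def[symmetric] max_def)
    moreover have "the_inv_into (half_strip (scherk_l s)) (scherk_Phi s) z = \<zeta>"
      using the_inv_into_f_f[OF inj_on_Phi \<zeta>(1)] Phi by simp
    moreover have "z \<in> scherk_Phi s ` half_strip (scherk_l s)" using Phi \<zeta>(1) by blast
    ultimately show ?thesis by (simp add: scherk_on_strip_def)
  next
    case False
    have "z \<notin> scherk_Phi s ` half_strip (scherk_l s)"
    proof
      assume "z \<in> scherk_Phi s ` half_strip (scherk_l s)"
      then obtain \<zeta> where \<zeta>: "\<zeta> \<in> half_strip (scherk_l s)" "z = scherk_Phi s \<zeta>" by auto
      then have "p = flat \<zeta>" using G_flat[OF \<zeta>(1)] inv_G_eqI[of "flat \<zeta>" z] by (simp add: p_def)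
      then show False using level_flat_pos[OF \<zeta>(1)] False by simp
    qed
    moreover have "height z = 0"
      using False norm_W_less[of p] by (simp add: height_def p_def[symmetric] max_def)
    ultimately show ?thesis by (simp add: scherk_on_strip_def)
  qed
qed


lemma scherk_eq_height: "scherk s = height"
  unfolding scherk_def
proof (rule the_equality)
  show "continuous_on UNIV height \<and> (\<forall>z\<in>half_strip (2 * pi). height z = scherk_on_strip s z) \<and>
    (\<forall>z. height (- cnj z) = height z) \<and> (\<forall>z. height (cnj z) = height z) \<and> (\<forall>z. height (z + 2 * of_real pi * \<i>) = height z)"
    using continuous_height height_on_strip height_symmetric by blast
  fix S
  assume "continuous_on UNIV S \<and> (\<forall>z\<in>half_strip (2 * pi). S z = scherk_on_strip s z) \<and>
    (\<forall>z. S (- cnj z) = S z) \<and> (\<forall>z. S (cnj z) = S z) \<and> (\<forall>z. S (z + 2 * of_real pi * \<i>) = S z)"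
  then show "S = height"
    by (intro symmetric_extension_unique) (auto simp: continuous_height height_on_strip height_symmetric)
qed

section \<open>The free boundary and its loop\<close>

text \<open>Every zero of \<open>level\<close> is a limit of positive values, because \<open>level\<close> increases strictly with the distance
  from the imaginary axis.\<close>

lemma frontier_level: "frontier {p. 0 < level p} = {p. level p = 0}"
proof -
  have op: "open {p. 0 < level p}" 
    by (rule open_Collect_less) (use continuous_level in auto)
  have cl: "closed {p. 0 \<le> level p}"
    by (rule closed_Collect_le) (use continuous_level in auto)
  have closure: "closure {p. 0 < level p} = {p. 0 \<le> level p}"
  proof (rule antisym)
    show "closure {p. 0 < level p} \<subseteq> {p. 0 \<le> level p}" by (rule closure_minimal[OF _ cl]) auto
    show "{p. 0 \<le> level p} \<subseteq> closure {p. 0 < level p}"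
    proof (rule subsetI, unfold closure_approachable, intro allI impI)
      fix p and d :: real assume p: "p \<in> {p. 0 \<le> level p}" and d: "0 < d"
      define e :: real where "e = (if 0 \<le> Re p then 1 else -1)"
      let ?y = "p + of_real (e * (d / 2))"
      have "cosh \<bar>Re p\<bar> < cosh \<bar>Re ?y\<bar>"
        using d by (subst cosh_real_nonneg_less_iff) (auto simp: e_def)
      then have "cosh (Re p) < cosh (Re ?y)" by (simp only: cosh_real_abs)
      then have "A * cosh (Re p) < A * cosh (Re ?y)" using AB by (intro mult_strict_left_mono) auto
      then have "level p < level ?y" by (simp add: level_def)
      then have "0 < level ?y" using p by simp
      moreover have "dist ?y p < d" using d by (simp add: dist_norm norm_mult e_def)
      ultimately show "\<exists>y\<in>{p. 0 < level p}. dist y p < d" by blast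
    qed
  qed
  have "{p. 0 \<le> level p} - {p. 0 < level p} = {p. level p = 0}"
    by (intro set_eqI) (simp add: order.order_iff_strict, linarith)
  then show ?thesis unfolding frontier_def interior_open[OF op] closure .
qed

lemma free_boundary_eq: "free_boundary (scherk s) = G ` {p. level p = 0}"
proof -
  have hom: "homeomorphic_map euclidean euclidean G"
    using homeomorphism_G unfolding homeomorphism_def homeomorphic_map_maps homeomorphic_maps_def
    by (intro exI[of _ "inv G"]) auto
  have "{z. 0 < height z} = G ` {p. 0 < level p}"
  proof (intro set_eqI iffI)
    fix z assume "z \<in> {z. 0 < height z}"
    then have "inv G z \<in> {p. 0 < level p}" by (simp add: height_pos_iff)
    then have "G (inv G z) \<in> G ` {p. 0 < level p}" by (rule imageI)
    then show "z \<in> G ` {p. 0 < level p}" by simp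
  qed (auto simp: height_pos_iff)
  then show ?thesis
    unfolding free_boundary_def scherk_eq_height
    using homeomorphic_map_frontier_of[OF hom, of "{p. 0 < level p}"] by (simp add: frontier_level)
qed

definition loop :: "complex set" where "loop = {p. level p = 0 \<and> \<bar>Im p\<bar> < pi}"

text \<open>The loop is the union of two graphs \<open>y = \<plusminus> arccos (A cosh x / B)\<close> over a common interval, which meet at the
  end of that interval, where the argument of \<open>arccos\<close> is one.\<close>

lemma connected_loop: "connected loop" and loop_nonempty: "loop \<noteq> {}"
proof -
  define I where "I = {x. A * cosh x \<le> B}"
  define \<theta> where "\<theta> x = arccos (A * cosh x / B)" for x
  define arc where "arc e x = of_real x + \<i> * of_real (e * \<theta> x)" for e x :: real
  have rng: "0 < A * cosh x / B" "A * cosh x / B \<le> 1" if "x \<in> I" for x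
    using that AB by (auto simp: I_def)
  have rng': "-1 \<le> A * cosh x / B" if "x \<in> I" for x using rng(1)[OF that] by linarith
  have "is_interval I"
    unfolding is_interval_1
  proof (intro ballI allI impI)
    fix a b x assume ab: "a \<in> I" "b \<in> I" "a \<le> x \<and> x \<le> b"
    define m where "m = max \<bar>a\<bar> \<bar>b\<bar>"
    have "cosh \<bar>x\<bar> \<le> cosh m" using ab(3) by (subst cosh_real_nonneg_le_iff) (auto simp: m_def)
    then have "cosh x \<le> max (cosh a) (cosh b)" by (auto simp: m_def max_def split: if_splits)
    then have "A * cosh x \<le> A * max (cosh a) (cosh b)" using AB by (intro mult_left_mono) auto
    also have "\<dots> \<le> B" using ab by (auto simp: I_def max_def)
    finally show "x \<in> I" by (simp add: I_def)
  qed
  then have "connected I" by (rule is_interval_connected)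
  have "continuous_on I \<theta>"
    unfolding \<theta>_def using rng(2) rng' AB(3) by (intro continuous_intros) auto
  then have conn: "connected (arc e ` I)" for e
    unfolding arc_def using \<open>connected I\<close> by (intro connected_continuous_image continuous_intros)
  have "loop = arc 1 ` I \<union> arc (-1) ` I"
  proof (intro set_eqI iffI)
    fix p assume "p \<in> loop"
    then have p: "level p = 0" "\<bar>Im p\<bar> < pi" by (auto simp: loop_def)
    then have c: "A * cosh (Re p) = B * cos \<bar>Im p\<bar>" by (simp add: level_def)
    have "B * cos \<bar>Im p\<bar> \<le> B * 1" using AB by (intro mult_left_mono) auto
    then have "Re p \<in> I" using c by (simp add: I_def)
    moreover have "\<theta> (Re p) = \<bar>Im p\<bar>" unfolding \<theta>_def c using AB(3) p arccos_cos[of "\<bar>Im p\<bar>"] by simp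
    then have "p = arc 1 (Re p) \<or> p = arc (-1) (Re p)" by (auto simp: arc_def complex_eq_iff)
    ultimately show "p \<in> arc 1 ` I \<union> arc (-1) ` I" by blast
  next
    fix p assume "p \<in> arc 1 ` I \<union> arc (-1) ` I"
    then obtain e x where x: "x \<in> I" "p = arc e x" "e = 1 \<or> e = -1" by blast
    have "cos (\<theta> x) = A * cosh x / B" unfolding \<theta>_def using rng[OF x(1)] by (intro cos_arccos) auto
    moreover have "0 \<le> \<theta> x" "\<theta> x \<le> pi" unfolding \<theta>_def using rng[OF x(1)] by (auto intro: arccos_lbound arccos_ubound)
    moreover have "\<theta> x \<noteq> pi" using calculation(1) rng(1)[OF x(1)] by auto
    ultimately show "p \<in> loop" using x AB by (auto simp: loop_def arc_def level_def)
  qed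
  moreover define X where "X = arcosh (B / A)"
  have "cosh X = B / A" unfolding X_def using AB by (intro cosh_arcosh_real) simp
  then have "X \<in> I" "\<theta> X = 0" using AB by (auto simp: I_def \<theta>_def)
  then have "of_real X \<in> arc 1 ` I \<inter> arc (-1) ` I" by (force simp: arc_def)
  ultimately show "connected loop" "loop \<noteq> {}" using conn connected_Un[of "arc 1 ` I" "arc (-1) ` I"] by auto
qed

text \<open>On the loop \<open>G\<close> is the linear map \<open>A x + \<i> B y\<close>. That the image stays in \<open>\<bar>Im z\<bar> < pi\<close>, although
  \<open>B > 1\<close>, follows from the symmetry of \<open>G\<close> in the lines \<open>\<bar>Im q\<bar> = pi\<close>.\<close>

lemma G_loop:
  "G ` loop = {z. \<bar>Im z\<bar> < pi \<and> A * cosh (Re z / A) = B * cos (Im z / B)}"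
proof (intro set_eqI iffI)
  fix z assume "z \<in> G ` loop"
  then obtain p where p: "z = G p" "level p = 0" "\<bar>Im p\<bar> < pi" by (auto simp: loop_def)
  then have "G p = Complex (A * Re p) (B * Im p)" by (intro G_linear) auto
  then show "z \<in> {z. \<bar>Im z\<bar> < pi \<and> A * cosh (Re z / A) = B * cos (Im z / B)}"
    using p AB abs_Im_G_less_iff[of p] by (auto simp: level_def)
next
  fix z assume z: "z \<in> {z. \<bar>Im z\<bar> < pi \<and> A * cosh (Re z / A) = B * cos (Im z / B)}"
  define p where "p = Complex (Re z / A) (Im z / B)"
  have "\<bar>Im z\<bar> / B \<le> \<bar>Im z\<bar> / 1" using AB by (intro divide_left_mono) auto
  then have im: "\<bar>Im p\<bar> < pi" using z AB by (simp add: p_def)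
  have level: "level p = 0" using z by (simp add: p_def level_def)
  then have "G p = Complex (A * Re p) (B * Im p)" using im by (intro G_linear) auto
  then have "G p = z" using AB by (simp add: p_def complex_eq_iff)
  then show "z \<in> G ` loop" using level im by (auto simp: loop_def)
qed

text \<open>By \<open>Im_G_near\<close> only points with \<open>Im p = pi\<close> are sent to the line \<open>Im z = pi\<close>, and there \<open>level\<close> is positive
  since \<open>cos pi = -1\<close>.\<close>

lemma free_boundary_avoids_line:
  assumes "z \<in> free_boundary (scherk s)" shows "\<bar>Im z\<bar> \<noteq> pi"
proof -
  obtain p where p: "z = G p" "level p = 0" using assms by (auto simp: free_boundary_eq)
  have key: "Im (G p) \<noteq> pi" if "level p = 0" for p
  proof
    assume "Im (G p) = pi"
    then have "\<bar>Im p - pi\<bar> \<le> lip * \<bar>Im p - pi\<bar>" using Im_G_near[of p] by (simp add: abs_minus_commute)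
    then have "(1 - lip) * \<bar>Im p - pi\<bar> \<le> 0" by (simp add: algebra_simps)
    then have "Im p = pi" using lip by (simp add: mult_le_0_iff)
    then have "level p = A * cosh (Re p) + B" by (simp add: level_def)
    moreover have "0 < A * cosh (Re p)" using AB by simp
    ultimately show False using that AB by simp
  qed
  have "Im (G p) \<noteq> pi" "Im (G (cnj p)) \<noteq> pi" using key p(2) by (auto simp: level_symmetric)
  then show ?thesis by (auto simp: p(1) G_symmetric abs_if)
qed

lemma strip_part_of_free_boundary:
  "free_boundary (scherk s) \<inter> {z. \<bar>Im z\<bar> < pi} = G ` loop"
  by (auto simp: free_boundary_eq loop_def abs_Im_G_less_iff)

lemma scherk_loop_eq: "scherk_loop s = G ` loop"
  unfolding scherk_loop_def
proof (rule the_equality)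
  let ?FB = "free_boundary (scherk s)"
  have "continuous_on UNIV G" using homeomorphism_G by (simp add: homeomorphism_def)
  then have conn: "connected (G ` loop)"
    using connected_loop by (intro connected_continuous_image) (auto intro: continuous_on_subset)
  have "G ` loop \<in> components ?FB"
    unfolding in_components_maximal
  proof (intro conjI allI impI)
    show "G ` loop \<noteq> {}" using loop_nonempty by simp
    show "G ` loop \<subseteq> ?FB" using strip_part_of_free_boundary by blast
    show "connected (G ` loop)" by (rule conn)
    fix D assume D: "D \<noteq> {} \<and> G ` loop \<subseteq> D \<and> D \<subseteq> ?FB \<and> connected D"
    have o: "open {z. \<bar>Im z\<bar> < pi}" "open {z. pi < \<bar>Im z\<bar>}"
      by (intro open_Collect_less continuous_intros)+
    have "{z. \<bar>Im z\<bar> < pi} \<inter> D = {} \<or> {z. pi < \<bar>Im z\<bar>} \<inter> D = {}"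
      using D free_boundary_avoids_line by (intro connectedD[OF _ o]) force+
    moreover have "{z. \<bar>Im z\<bar> < pi} \<inter> D \<noteq> {}" using D loop_nonempty strip_part_of_free_boundary by blast
    ultimately have "D \<subseteq> {z. \<bar>Im z\<bar> < pi}" using D free_boundary_avoids_line by force
    then show "D = G ` loop" using D strip_part_of_free_boundary by blast
  qed
  then show comp: "G ` loop \<in> components ?FB \<and> G ` loop \<subseteq> {z. \<bar>Im z\<bar> < pi}"
    using strip_part_of_free_boundary by blast
  fix C assume C: "C \<in> components ?FB \<and> C \<subseteq> {z. \<bar>Im z\<bar> < pi}"
  then have sub: "C \<subseteq> G ` loop" using in_components_subset[of C ?FB] strip_part_of_free_boundary by blast
  have "C \<noteq> {}" using C in_components_nonempty by blast
  then have "G ` loop \<subseteq> C"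
    using C conn comp sub in_components_subset[of "G ` loop" ?FB] by (intro components_maximal[of C ?FB]) auto
  then show "C = G ` loop" using sub by blast
qed

end

theorem mainTheorem2:
  fixes s :: real
  assumes "0 < s" and "s < 1"
  shows "scherk_loop s =
    {z. \<bar>Im z\<bar> < pi \<and>
        (1 - s\<^sup>2) * cosh (Re z / (1 - s\<^sup>2)) = (1 + s\<^sup>2) * cos (Im z / (1 + s\<^sup>2))}"
proof -
  interpret scherk_slope s using assms by unfold_locales
  show ?thesis using scherk_loop_eq G_loop unfolding A_def B_def by simp
qed

end
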